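(* Let $\bullet$ be $*$ or $\rho$. Then: (1) ${}^{\bullet}\mathbb R$ is a real closed, Cantor complete and non-Archimedean extension of $\mathbb R$. (2) ${}^{\bullet}\mathbb C$ is an algebraically closed field of the form ${}^{\bullet}\mathbb C={}^{\bullet}\mathbb R+\sqrt{-1}\,{}^{\bullet}\mathbb R$.
   Context: $\mathbb N$ is the set of nonnegative integers, $\mathcal U$ a fixed free ultrafilter on $\mathbb N$; "$P(n)$ a.e." means $\{n\in\mathbb N: P(n)\}\in\mathcal U$. For $\mathbb F=\mathbb R,\mathbb C$, ${}^*\mathbb F=\mathbb F^{\mathbb N}/\{(x_n): x_n=0\text{ a.e.}\}$ with levelwise operations, and in ${}^*\mathbb R$ $[a_n]\le[b_n]$ iff $a_n\le b_n$ a.e. ${}^*\mathbb N\subset{}^*\mathbb R$ is the image of $\mathbb N^{\mathbb N}$, and $\rho\in{}^*\mathbb R$ is the positive infinitesimal represented by $(1/n)$. ${}^{\rho}\mathbb F={}^{\rho}\mathbf M({}^*\mathbb F)/{}^{\rho}\mathbf N({}^*\mathbb F)$, where ${}^{\rho}\mathbf M({}^*\mathbb F)=\{x\in{}^*\mathbb F:\exists c\in{}^*\mathbb N,\ |x|\le\rho^{-c}\}$ and ${}^{\rho}\mathbf N({}^*\mathbb F)=\{x\in{}^*\mathbb F:\forall d\in{}^*\mathbb N,\ |x|\le\rho^{d}\}$. Cantor complete means that every nested sequence of bounded closed intervals has non-empty intersection. *)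

theory Defs
  imports Complex_Main "HOL-Algebra.Algebraic_Closure_Type"
begin

section \<open>Ordered fields\<close>

locale ordered_field = field R for R (structure) +
  fixes leq :: "'a \<Rightarrow> 'a \<Rightarrow> bool" (infix "\<preceq>" 50)
  assumes le_refl: "x \<in> carrier R \<Longrightarrow> x \<preceq> x"
    and le_antisym: "\<lbrakk>x \<in> carrier R; y \<in> carrier R; x \<preceq> y; y \<preceq> x\<rbrakk> \<Longrightarrow> x = y"
    and le_trans: "\<lbrakk>x \<in> carrier R; y \<in> carrier R; z \<in> carrier R; x \<preceq> y; y \<preceq> z\<rbrakk> \<Longrightarrow> x \<preceq> z"
    and le_total: "\<lbrakk>x \<in> carrier R; y \<in> carrier R\<rbrakk> \<Longrightarrow> x \<preceq> y \<or> y \<preceq> x"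
    and le_add: "\<lbrakk>x \<in> carrier R; y \<in> carrier R; z \<in> carrier R; x \<preceq> y\<rbrakk> \<Longrightarrow> x \<oplus> z \<preceq> y \<oplus> z"
    and le_mult: "\<lbrakk>x \<in> carrier R; y \<in> carrier R; \<zero> \<preceq> x; \<zero> \<preceq> y\<rbrakk> \<Longrightarrow> \<zero> \<preceq> x \<otimes> y"

locale real_closed_field = ordered_field +
  assumes sqrt_exists: "\<lbrakk>x \<in> carrier R; \<zero> \<preceq> x\<rbrakk> \<Longrightarrow> \<exists>y \<in> carrier R. y \<otimes> y = x"
    and odd_degree_root: "\<lbrakk>p \<in> carrier (poly_ring R); odd (Polynomials.degree p)\<rbrakk>
      \<Longrightarrow> \<exists>x \<in> carrier R. eval p x = \<zero>"

definition closed_interval ::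
    "('a, 'm) ring_scheme \<Rightarrow> ('a \<Rightarrow> 'a \<Rightarrow> bool) \<Rightarrow> 'a \<Rightarrow> 'a \<Rightarrow> 'a set" where
  "closed_interval R leq a b = {x \<in> carrier R. leq a x \<and> leq x b}"

definition cantor_complete :: "('a, 'm) ring_scheme \<Rightarrow> ('a \<Rightarrow> 'a \<Rightarrow> bool) \<Rightarrow> bool" where
  "cantor_complete R leq \<longleftrightarrow>
     (\<forall>a b. (\<forall>n::nat. a n \<in> carrier R \<and> b n \<in> carrier R \<and> leq (a n) (b n)) \<and>
            (\<forall>n. closed_interval R leq (a (Suc n)) (b (Suc n)) \<subseteq> closed_interval R leq (a n) (b n))
        \<longrightarrow> (\<Inter>n. closed_interval R leq (a n) (b n)) \<noteq> {})"

definition archimedean :: "('a, 'm) ring_scheme \<Rightarrow> ('a \<Rightarrow> 'a \<Rightarrow> bool) \<Rightarrow> bool" where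
  "archimedean R leq \<longleftrightarrow> (\<forall>x \<in> carrier R. \<exists>n::nat. leq x ([n] \<cdot>\<^bsub>R\<^esub> \<one>\<^bsub>R\<^esub>))"

definition ordered_embedding ::
    "('a, 'm) ring_scheme \<Rightarrow> ('a \<Rightarrow> 'a \<Rightarrow> bool) \<Rightarrow> ('b, 'n) ring_scheme \<Rightarrow> ('b \<Rightarrow> 'b \<Rightarrow> bool)
      \<Rightarrow> ('a \<Rightarrow> 'b) \<Rightarrow> bool" where
  "ordered_embedding R leR S leS f \<longleftrightarrow>
     f \<in> ring_hom R S \<and> inj_on f (carrier R) \<and>
     (\<forall>x \<in> carrier R. \<forall>y \<in> carrier R. leS (f x) (f y) \<longleftrightarrow> leR x y)"

abbreviation real_ring :: "real ring" where
  "real_ring \<equiv> ring_of_type_algebra"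

text \<open>\<open>C = R + jR\<close> with \<open>j = \<surd>-1\<close>, where \<open>R\<close> is regarded as a subring of \<open>C\<close> via
  the embedding \<open>e\<close>.\<close>

definition is_complexification ::
    "('a, 'm) ring_scheme \<Rightarrow> ('b, 'n) ring_scheme \<Rightarrow> ('a \<Rightarrow> 'b) \<Rightarrow> 'b \<Rightarrow> bool" where
  "is_complexification R C e j \<longleftrightarrow>
     e \<in> ring_hom R C \<and> inj_on e (carrier R) \<and>
     j \<in> carrier C \<and> j \<otimes>\<^bsub>C\<^esub> j = \<ominus>\<^bsub>C\<^esub> \<one>\<^bsub>C\<^esub> \<and>
     carrier C = {e x \<oplus>\<^bsub>C\<^esub> j \<otimes>\<^bsub>C\<^esub> e y | x y. x \<in> carrier R \<and> y \<in> carrier R}"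


section \<open>The fields \<open>\<^sup>*\<real>\<close> and \<open>\<^sup>*\<complex>\<close>\<close>

text \<open>A family of sets \<open>\<U>\<close> is represented by the filter \<open>U\<close> for which \<open>eventually P U\<close> means
  \<open>{n. P n} \<in> \<U>\<close>, i.e. \<open>P\<close> holds almost everywhere.\<close>

definition free_ultrafilter :: "nat filter \<Rightarrow> bool" where
  "free_ultrafilter U \<longleftrightarrow>
     U \<noteq> bot \<and>
     (\<forall>P. eventually P U \<or> eventually (\<lambda>n. \<not> P n) U) \<and>
     (\<forall>P. eventually P U \<longrightarrow> infinite {n. P n})"

definition seq_ring :: "(nat \<Rightarrow> 'a::comm_ring_1) ring" where
  "seq_ring = \<lparr>carrier = UNIV, monoid.mult = (\<lambda>x y n. x n * y n), one = (\<lambda>_. 1),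
               ring.zero = (\<lambda>_. 0), add = (\<lambda>x y n. x n + y n)\<rparr>"

definition null_seqs :: "nat filter \<Rightarrow> (nat \<Rightarrow> 'a::comm_ring_1) set" where
  "null_seqs U = {x. \<forall>\<^sub>F n in U. x n = 0}"

definition star_field :: "nat filter \<Rightarrow> (nat \<Rightarrow> 'a::real_normed_field) set ring" where
  "star_field U = seq_ring Quot null_seqs U"

definition star :: "nat filter \<Rightarrow> (nat \<Rightarrow> 'a::real_normed_field) \<Rightarrow> (nat \<Rightarrow> 'a) set" where
  "star U x = null_seqs U +>\<^bsub>seq_ring\<^esub> x"

definition star_le :: "nat filter \<Rightarrow> (nat \<Rightarrow> real) set \<Rightarrow> (nat \<Rightarrow> real) set \<Rightarrow> bool" where
  "star_le U A B \<longleftrightarrow> (\<exists>x \<in> A. \<exists>y \<in> B. \<forall>\<^sub>F n in U. x n \<le> y n)"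

text \<open>In the following two levelwise liftings, all members of the union are equal, because
  the classes obtained do not depend on the representatives.\<close>

definition star_map ::
    "nat filter \<Rightarrow> ('a::real_normed_field \<Rightarrow> 'b::real_normed_field) \<Rightarrow> (nat \<Rightarrow> 'a) set \<Rightarrow> (nat \<Rightarrow> 'b) set"
  where "star_map U f A = (\<Union>x \<in> A. star U (\<lambda>n. f (x n)))"

definition star_map2 ::
    "nat filter \<Rightarrow> ('a::real_normed_field \<Rightarrow> 'b::real_normed_field \<Rightarrow> 'c::real_normed_field)
      \<Rightarrow> (nat \<Rightarrow> 'a) set \<Rightarrow> (nat \<Rightarrow> 'b) set \<Rightarrow> (nat \<Rightarrow> 'c) set"
  where "star_map2 U f A B = (\<Union>x \<in> A. \<Union>y \<in> B. star U (\<lambda>n. f (x n) (y n)))"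

definition star_nats :: "nat filter \<Rightarrow> (nat \<Rightarrow> real) set set" where
  "star_nats U = {star U (\<lambda>n. real (k n)) | k. True}"

definition standard_nats :: "nat filter \<Rightarrow> (nat \<Rightarrow> real) set set" where
  "standard_nats U = {star U (\<lambda>_. real m) | m. True}"


section \<open>The fields \<open>\<^sup>\<rho>\<real>\<close> and \<open>\<^sup>\<rho>\<complex>\<close>\<close>

text \<open>The value at \<open>n = 0\<close> (where \<open>1 / 0 = 0\<close>) does not affect the class, as \<open>U\<close> is free.\<close>

definition rho :: "nat filter \<Rightarrow> (nat \<Rightarrow> real) set" where
  "rho U = star U (\<lambda>n. 1 / real n)"

text \<open>The set \<open>E\<close> is the range of the exponents: \<open>star_nats U\<close>, or \<open>standard_nats U\<close> for
  Robinson's field of asymptotic numbers. These differ: if \<open>E\<close> is \<open>star_nats U\<close>, which contains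
  infinite exponents, then all elements are moderate and only 0 is negligible.\<close>

definition moderate ::
    "nat filter \<Rightarrow> (nat \<Rightarrow> real) set set \<Rightarrow> (nat \<Rightarrow> 'a::real_normed_field) set set" where
  "moderate U E = {x \<in> carrier (star_field U).
     \<exists>c \<in> E. star_le U (star_map U norm x) (star_map2 U (powr) (rho U) (\<ominus>\<^bsub>star_field U\<^esub> c))}"

definition negligible ::
    "nat filter \<Rightarrow> (nat \<Rightarrow> real) set set \<Rightarrow> (nat \<Rightarrow> 'a::real_normed_field) set set" where
  "negligible U E = {x \<in> carrier (star_field U).
     \<forall>d \<in> E. star_le U (star_map U norm x) (star_map2 U (powr) (rho U) d)}"

definition rho_field ::
    "nat filter \<Rightarrow> (nat \<Rightarrow> real) set set \<Rightarrow> (nat \<Rightarrow> 'a::real_normed_field) set set ring" where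
  "rho_field U E = (star_field U \<lparr>carrier := moderate U E\<rparr>) Quot (negligible U E)"

definition rho_class ::
    "nat filter \<Rightarrow> (nat \<Rightarrow> real) set set \<Rightarrow> (nat \<Rightarrow> 'a::real_normed_field) set
      \<Rightarrow> (nat \<Rightarrow> 'a) set set" where
  "rho_class U E x = negligible U E +>\<^bsub>star_field U\<^esub> x"

definition rho_le ::
    "nat filter \<Rightarrow> (nat \<Rightarrow> real) set set \<Rightarrow> (nat \<Rightarrow> real) set set \<Rightarrow> bool" where
  "rho_le U A B \<longleftrightarrow> (\<exists>x \<in> A. \<exists>y \<in> B. star_le U x y)"


section \<open>Canonical embeddings\<close>

definition real_to_star :: "nat filter \<Rightarrow> real \<Rightarrow> (nat \<Rightarrow> real) set" where
  "real_to_star U r = star U (\<lambda>_. r)"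

definition real_to_rho ::
    "nat filter \<Rightarrow> (nat \<Rightarrow> real) set set \<Rightarrow> real \<Rightarrow> (nat \<Rightarrow> real) set set" where
  "real_to_rho U E r = rho_class U E (real_to_star U r)"

definition star_complex_of_real :: "nat filter \<Rightarrow> (nat \<Rightarrow> real) set \<Rightarrow> (nat \<Rightarrow> complex) set" where
  "star_complex_of_real U = star_map U complex_of_real"

definition rho_complex_of_real ::
    "nat filter \<Rightarrow> (nat \<Rightarrow> real) set set \<Rightarrow> (nat \<Rightarrow> real) set set \<Rightarrow> (nat \<Rightarrow> complex) set set" where
  "rho_complex_of_real U E A = (\<Union>x \<in> A. rho_class U E (star_complex_of_real U x))"

definition star_ii :: "nat filter \<Rightarrow> (nat \<Rightarrow> complex) set" where
  "star_ii U = star U (\<lambda>_. \<i>)"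

definition rho_ii ::
    "nat filter \<Rightarrow> (nat \<Rightarrow> real) set set \<Rightarrow> (nat \<Rightarrow> complex) set set" where
  "rho_ii U E = rho_class U E (star_ii U)"

abbreviation star_real :: "nat filter \<Rightarrow> (nat \<Rightarrow> real) set ring" where
  "star_real \<equiv> star_field"

abbreviation star_complex :: "nat filter \<Rightarrow> (nat \<Rightarrow> complex) set ring" where
  "star_complex \<equiv> star_field"

abbreviation rho_real ::
    "nat filter \<Rightarrow> (nat \<Rightarrow> real) set set \<Rightarrow> (nat \<Rightarrow> real) set set ring" where
  "rho_real \<equiv> rho_field"

abbreviation rho_complex ::
    "nat filter \<Rightarrow> (nat \<Rightarrow> real) set set \<Rightarrow> (nat \<Rightarrow> complex) set set ring" where
  "rho_complex \<equiv> rho_field"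

end

theory Submission
  imports Defs
begin

text \<open>
  All fields in question have the same shape: their elements are classes of sequences of reals or
  complex numbers whose norms obey some growth bound, and two sequences give the same element iff
  their difference is negligible, which means that its norm is eventually (with respect to the
  ultrafilter) below each of countably many thresholds. For \<open>\<^sup>*\<real>\<close> and \<open>\<^sup>*\<complex>\<close> every growth is
  permitted and the only threshold is 0. For \<open>\<^sup>\<rho>\<real>\<close> and \<open>\<^sup>\<rho>\<complex>\<close> with standard exponents the bounds
  are the powers of \<open>n\<close> and the thresholds are the powers of \<open>1/n\<close>. With nonstandard exponents
  the powers \<open>n ^ k n\<close> dominate every sequence, so one is back in the case of \<open>\<^sup>*\<real>\<close> and \<open>\<^sup>*\<complex>\<close>.
  The locale \<open>growth_scale\<close> axiomatizes bounds and thresholds, the locale \<open>sequence_model\<close> the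
  passage to classes, and every claim is proved once, in these locales.

  A non-negligible sequence exceeds some threshold almost everywhere, because \<open>U\<close> is an
  ultrafilter; hence its inverse is again moderate, and the classes form a field. For a polynomial
  one lifts the coefficients to sequences and picks a root of the polynomial at each level \<open>n\<close>.
  The sequence of roots is moderate by the elementary bound of \<open>norm_root_le\<close>, since the inverse
  of the leading coefficient is moderate. This reduces root existence to the
  intermediate value theorem over \<open>\<real>\<close> and to the fundamental theorem of algebra over \<open>\<complex>\<close>
  (\<open>root_exists\<close>). Square roots of nonnegative elements are likewise taken levelwise.

  Cantor completeness is a diagonal argument, \<open>cantor_complete_K\<close>: the inequalities between the
  first \<open>m\<close> left and right endpoints hold, up to the \<open>m\<close>-th threshold, at almost every level. At
  level \<open>n\<close> one takes the largest of the first \<open>m\<close> left endpoints, with \<open>m\<close> as large as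
  these inequalities and \<open>m \<le> n\<close> allow. As \<open>m\<close> tends to infinity along \<open>U\<close>, the error
  falls below every threshold. It is here that countably many thresholds matter. The class of the
  identity sequence exceeds all natural numbers, and the decomposition of the complex field is the
  levelwise decomposition into real and imaginary parts.
\<close>

section \<open>Levelwise polynomial roots\<close>

lemma norm_poly_Poly_rev_le:
  fixes z :: "'a::real_normed_field"
  assumes "1 \<le> norm z"
  shows "norm (poly (Poly (rev p)) z) \<le> sum_list (map norm p) * norm z ^ (length p - 1)"
proof (induction p)
  case Nil
  then show ?case by simp
next
  case (Cons a p)
  have "norm (poly (Poly (rev (a # p))) z) \<le> norm (poly (Poly (rev p)) z) + norm a * norm z ^ length p"
    by (simp add: Poly_snoc poly_monom norm_mult norm_power norm_triangle_le)
  also have "\<dots> \<le> sum_list (map norm p) * norm z ^ (length p - 1) + norm a * norm z ^ length p"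
    using Cons.IH by simp
  also have "\<dots> \<le> sum_list (map norm p) * norm z ^ length p + norm a * norm z ^ length p"
    by (intro add_right_mono mult_left_mono power_increasing assms sum_list_nonneg) auto
  finally show ?case by (simp add: algebra_simps)
qed

text \<open>The bound is linear in the coefficients and in the inverse of the leading one, so it stays
  moderate when these vary moderately with the level.\<close>

lemma norm_root_le:
  fixes z :: "'a::real_normed_field"
  assumes root: "poly (Poly (rev (a # p))) z = 0" and a: "a \<noteq> 0"
  shows "norm z \<le> 1 + sum_list (map norm p) * inverse (norm a)"
proof (cases "1 \<le> norm z \<and> p \<noteq> []")
  case True
  define k where "k = length p - 1"
  have k: "length p = Suc k" using True by (cases p) (auto simp: k_def)
  have "a * z ^ length p = - poly (Poly (rev p)) z"
    using root by (simp add: Poly_snoc poly_monom eq_neg_iff_add_eq_0 add.commute)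
  then have "norm a * norm z ^ Suc k = norm (poly (Poly (rev p)) z)"
    by (metis norm_minus_cancel norm_mult norm_power k)
  also have "\<dots> \<le> sum_list (map norm p) * norm z ^ k"
    using norm_poly_Poly_rev_le[of z p] True by (simp add: k_def)
  finally have "(norm a * norm z) * norm z ^ k \<le> sum_list (map norm p) * norm z ^ k"
    by (simp add: mult.assoc)
  moreover have "norm z ^ k > 0" using True by (intro zero_less_power) linarith
  ultimately have "norm a * norm z \<le> sum_list (map norm p)" by simp
  then have "norm z \<le> sum_list (map norm p) * inverse (norm a)"
    using a by (simp add: field_simps)
  then show ?thesis by simp
next
  case False
  have "0 \<le> sum_list (map norm p) * inverse (norm a)"
    by (intro mult_nonneg_nonneg sum_list_nonneg) auto
  moreover have "norm z \<le> 1"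
    using False root a by (auto simp: Poly_snoc poly_monom)
  ultimately show ?thesis by linarith
qed

lemma odd_degree_real_poly_root:
  fixes p :: "real poly"
  assumes "odd (Polynomial.degree p)"
  shows "\<exists>x. poly p x = 0"
proof -
  have pos: "\<exists>x. poly q x = 0" if deg: "odd (Polynomial.degree q)" and lc: "lead_coeff q > 0" for q :: "real poly"
  proof -
    (* Reflection negates the leading term of a polynomial of odd degree, so r has the positive
       leading coefficient of q, and both q and r are eventually positive. *)
    define r where "r = - pcompose q [:0, -1:]"
    have "lead_coeff r = lead_coeff q"
      using deg by (simp add: r_def lead_coeff_comp)
    then obtain b where b: "\<And>x. x \<ge> b \<Longrightarrow> poly r x > 0"
      using poly_pinfty_gt_lc[of r] lc by fastforce
    obtain a where a: "\<And>x. x \<ge> a \<Longrightarrow> poly q x > 0"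
      using poly_pinfty_gt_lc[OF lc] lc by fastforce
    define c where "c = max 1 (max a b)"
    have "poly q (- c) < 0" using b[of c] by (simp add: r_def c_def poly_pcompose)
    moreover have "poly q c > 0" using a[of c] by (simp add: c_def)
    moreover have "- c < c" by (simp add: c_def)
    ultimately show ?thesis using poly_IVT_pos by blast
  qed
  have "p \<noteq> 0" using assms by auto
  then have "lead_coeff p > 0 \<or> lead_coeff (- p) > 0"
    by (auto simp: not_less less_le)
  then show ?thesis using pos[of p] pos[of "- p"] assms by auto
qed

lemma complex_poly_root:
  fixes p :: "complex poly"
  assumes "0 < Polynomial.degree p"
  shows "\<exists>z. poly p z = 0"
  using assms by (intro fundamental_theorem_of_algebra) (simp add: constant_degree)

section \<open>Growth bounds and negligibility thresholds\<close>

text \<open>The set \<open>B\<close> consists of the real sequences of admissible growth, and \<open>w 0 \<ge> w 1 \<ge> \<dots>\<close> are the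
  thresholds. The last two axioms tie them together: \<open>threshold_absorb\<close> makes the negligible
  sequences an ideal, and \<open>bound_inverse\<close> makes this ideal maximal.\<close>

locale growth_scale =
  fixes U :: "nat filter" and B :: "(nat \<Rightarrow> real) set" and w :: "nat \<Rightarrow> nat \<Rightarrow> real"
  assumes free_ultrafilter: "free_ultrafilter U"
    and bound_mono: "y \<in> B \<Longrightarrow> \<forall>\<^sub>F n in U. \<bar>x n\<bar> \<le> y n \<Longrightarrow> x \<in> B"
    and bound_add: "x \<in> B \<Longrightarrow> y \<in> B \<Longrightarrow> (\<lambda>n. x n + y n) \<in> B"
    and bound_mult: "x \<in> B \<Longrightarrow> y \<in> B \<Longrightarrow> (\<lambda>n. x n * y n) \<in> B"
    and bound_real: "real \<in> B"
    and threshold_nonneg: "0 \<le> w m n"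
    and threshold_le_1: "w m n \<le> 1"
    and threshold_antimono: "k \<le> m \<Longrightarrow> w m n \<le> w k n"
    and threshold_absorb: "y \<in> B \<Longrightarrow> \<exists>k. \<forall>\<^sub>F n in U. y n * w k n \<le> w m n"
    and bound_inverse: "\<forall>\<^sub>F n in U. w m n < x n \<Longrightarrow> (\<lambda>n. inverse (x n)) \<in> B"
begin

definition moderate_seq :: "(nat \<Rightarrow> 'a::real_normed_field) \<Rightarrow> bool" where
  "moderate_seq x \<longleftrightarrow> (\<lambda>n. norm (x n)) \<in> B"

definition negligible_seq :: "(nat \<Rightarrow> 'a::real_normed_field) \<Rightarrow> bool" where
  "negligible_seq x \<longleftrightarrow> (\<forall>m. \<forall>\<^sub>F n in U. norm (x n) \<le> w m n)"

lemma nontrivial: "U \<noteq> bot"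
  using free_ultrafilter by (simp add: free_ultrafilter_def)

lemma eventually_not: "\<not> eventually P U \<Longrightarrow> \<forall>\<^sub>F n in U. \<not> P n"
  using free_ultrafilter by (auto simp: free_ultrafilter_def)

text \<open>A free ultrafilter contains no finite set, hence every cofinite one.\<close>

lemma eventually_ge: "\<forall>\<^sub>F n in U. k \<le> n"
proof (rule ccontr)
  assume "\<not> (\<forall>\<^sub>F n in U. k \<le> n)"
  then have "infinite {n. \<not> k \<le> n}"
    using free_ultrafilter eventually_not by (auto simp: free_ultrafilter_def)
  moreover have "{n. \<not> k \<le> n} = {..<k}" by auto
  ultimately show False by simp
qed

lemma bound_const: "(\<lambda>_. c) \<in> B"
proof (rule bound_mono[OF bound_real])
  show "\<forall>\<^sub>F n in U. \<bar>c\<bar> \<le> real n"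
    using eventually_ge[of "nat \<lceil>\<bar>c\<bar>\<rceil>"] by eventually_elim linarith
qed

lemma moderate_seqI: "y \<in> B \<Longrightarrow> \<forall>\<^sub>F n in U. norm (x n) \<le> y n \<Longrightarrow> moderate_seq x"
  unfolding moderate_seq_def by (rule bound_mono) auto

lemma moderate_const: "moderate_seq (\<lambda>_. c)"
  by (simp add: moderate_seq_def bound_const)

lemma moderate_add: "moderate_seq x \<Longrightarrow> moderate_seq y \<Longrightarrow> moderate_seq (\<lambda>n. x n + y n)"
  by (rule moderate_seqI[OF bound_add, of "\<lambda>n. norm (x n)" "\<lambda>n. norm (y n)"])
    (auto simp: moderate_seq_def norm_triangle_ineq)

lemma moderate_uminus: "moderate_seq x \<Longrightarrow> moderate_seq (\<lambda>n. - x n)"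
  by (simp add: moderate_seq_def)

lemma moderate_diff: "moderate_seq x \<Longrightarrow> moderate_seq y \<Longrightarrow> moderate_seq (\<lambda>n. x n - y n)"
  using moderate_add[OF _ moderate_uminus, of x y] by simp

lemma moderate_mult: "moderate_seq x \<Longrightarrow> moderate_seq y \<Longrightarrow> moderate_seq (\<lambda>n. x n * y n)"
  by (auto simp: moderate_seq_def norm_mult bound_mult)

text \<open>The growth bound survives because \<open>sqrt t \<le> 1 + t\<close>.\<close>

lemma moderate_sqrt:
  fixes x :: "nat \<Rightarrow> real"
  assumes "moderate_seq x"
  shows "moderate_seq (\<lambda>n. sqrt (x n))"
proof (rule moderate_seqI)
  have abs_sqrt: "\<bar>sqrt t\<bar> = sqrt \<bar>t\<bar>" for t :: real
    by (cases "0 \<le> t") (auto simp: real_sqrt_minus)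
  show "(\<lambda>n. 1 + norm (x n)) \<in> B"
    using assms by (intro bound_add bound_const) (simp add: moderate_seq_def)
  have "sqrt \<bar>t\<bar> \<le> 1 + \<bar>t\<bar>" for t :: real
    by (rule real_le_lsqrt) (auto simp: power2_eq_square algebra_simps)
  then show "\<forall>\<^sub>F n in U. norm (sqrt (x n)) \<le> 1 + norm (x n)"
    by (simp add: abs_sqrt)
qed

lemma negligible_moderate:
  assumes "negligible_seq x" shows "moderate_seq x"
proof (rule moderate_seqI[OF bound_const[of 1]])
  have "\<forall>\<^sub>F n in U. norm (x n) \<le> w 0 n" using assms by (simp add: negligible_seq_def)
  then show "\<forall>\<^sub>F n in U. norm (x n) \<le> 1"
    by (rule eventually_mono) (use threshold_le_1[of 0] in \<open>auto intro: order_trans\<close>)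
qed

lemma negligible_mono:
  assumes "negligible_seq y" "\<forall>\<^sub>F n in U. norm (x n) \<le> norm (y n)"
  shows "negligible_seq x"
  unfolding negligible_seq_def
proof
  fix m
  have "\<forall>\<^sub>F n in U. norm (y n) \<le> w m n" using assms(1) by (simp add: negligible_seq_def)
  with assms(2) show "\<forall>\<^sub>F n in U. norm (x n) \<le> w m n" by eventually_elim linarith
qed

lemma negligible_mult:
  assumes "moderate_seq x" "negligible_seq y"
  shows "negligible_seq (\<lambda>n. x n * y n)"
  unfolding negligible_seq_def
proof
  fix m
  obtain k where "\<forall>\<^sub>F n in U. norm (x n) * w k n \<le> w m n"
    using threshold_absorb assms(1) by (auto simp: moderate_seq_def)
  moreover have "\<forall>\<^sub>F n in U. norm (y n) \<le> w k n"
    using assms(2) by (simp add: negligible_seq_def)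
  ultimately show "\<forall>\<^sub>F n in U. norm (x n * y n) \<le> w m n"
  proof eventually_elim
    case (elim n)
    have "norm (x n * y n) \<le> norm (x n) * w k n"
      unfolding norm_mult using elim(2) by (intro mult_left_mono) auto
    then show ?case using elim(1) by linarith
  qed
qed

lemma threshold_halve: "\<exists>k. \<forall>\<^sub>F n in U. 2 * w k n \<le> w m n"
  using threshold_absorb[OF bound_const] .

lemma negligible_add:
  assumes "negligible_seq x" "negligible_seq y"
  shows "negligible_seq (\<lambda>n. x n + y n)"
  unfolding negligible_seq_def
proof
  fix m
  obtain k where "\<forall>\<^sub>F n in U. 2 * w k n \<le> w m n"
    using threshold_halve by blast
  moreover have "\<forall>\<^sub>F n in U. norm (x n) \<le> w k n" "\<forall>\<^sub>F n in U. norm (y n) \<le> w k n"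
    using assms by (simp_all add: negligible_seq_def)
  ultimately show "\<forall>\<^sub>F n in U. norm (x n + y n) \<le> w m n"
  proof eventually_elim
    case (elim n)
    then show ?case using norm_triangle_ineq[of "x n" "y n"] by linarith
  qed
qed

lemma negligible_uminus_iff: "negligible_seq (\<lambda>n. - x n) \<longleftrightarrow> negligible_seq x"
  by (simp add: negligible_seq_def)

lemma negligible_zero: "negligible_seq (\<lambda>_. 0)"
  by (simp add: negligible_seq_def threshold_nonneg)

lemma negligible_const_iff: "negligible_seq (\<lambda>_. c) \<longleftrightarrow> c = 0"
proof
  assume neg: "negligible_seq (\<lambda>_. c)"
  show "c = 0"
  proof (rule ccontr)
    assume "c \<noteq> 0"
    then have "negligible_seq (\<lambda>_. 2 :: 'a)"
      using negligible_mult[OF moderate_const neg, of "2 / c"] by simp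
    then have "\<forall>\<^sub>F n in U. 2 \<le> w 0 n"
      by (simp add: negligible_seq_def)
    then have "\<forall>\<^sub>F n in U. False"
    proof eventually_elim
      case (elim n)
      then show ?case using threshold_le_1[of 0 n] by linarith
    qed
    then show False using nontrivial by simp
  qed
qed (simp add: negligible_zero)

text \<open>Over an ultrafilter the failure of one threshold estimate is an almost everywhere lower bound;
  this is why the quotient by the negligible sequences is a field.\<close>

lemma non_negligibleE:
  assumes "\<not> negligible_seq x"
  obtains m where "\<forall>\<^sub>F n in U. w m n < norm (x n)"
  using assms eventually_not unfolding negligible_seq_def not_le[symmetric] by blast

lemma non_negligible_nonzero: "\<not> negligible_seq x \<Longrightarrow> \<forall>\<^sub>F n in U. x n \<noteq> 0"
  using eventually_not[of "\<lambda>n. x n = 0"] negligible_mono[OF negligible_zero, of x]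
  by (auto elim: eventually_mono)

lemma moderate_inverse: "\<not> negligible_seq x \<Longrightarrow> moderate_seq (\<lambda>n. inverse (x n))"
  unfolding moderate_seq_def norm_inverse by (erule non_negligibleE) (rule bound_inverse)

end

section \<open>Fields of classes of moderate sequences\<close>

text \<open>The ring \<open>K\<close> is the quotient of the moderate sequences by the negligible ones, presented by
  its class map, so that the one-step quotient \<open>\<^sup>*\<real>\<close> and the two-step quotient \<open>\<^sup>\<rho>\<real>\<close> are
  both instances.\<close>

locale sequence_model = growth_scale U B w + cring K
  for U B w and K :: "('b, 'm) ring_scheme" (structure) +
  fixes cls :: "(nat \<Rightarrow> 'a::real_normed_field) \<Rightarrow> 'b"
  assumes carrier_eq: "carrier K = cls ` Collect moderate_seq"
    and cls_add: "moderate_seq x \<Longrightarrow> moderate_seq y \<Longrightarrow> cls (\<lambda>n. x n + y n) = cls x \<oplus> cls y"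
    and cls_mult: "moderate_seq x \<Longrightarrow> moderate_seq y \<Longrightarrow> cls (\<lambda>n. x n * y n) = cls x \<otimes> cls y"
    and cls_one: "cls (\<lambda>_. 1) = \<one>"
    and cls_eq_zero_iff: "moderate_seq x \<Longrightarrow> cls x = \<zero> \<longleftrightarrow> negligible_seq x"
begin

lemma cls_closed [simp]: "moderate_seq x \<Longrightarrow> cls x \<in> carrier K"
  by (simp add: carrier_eq)

lemma carrierE:
  assumes "a \<in> carrier K" obtains x where "moderate_seq x" "a = cls x"
  using assms by (auto simp: carrier_eq)

lemma cls_zero: "cls (\<lambda>_. 0) = \<zero>"
  by (simp add: cls_eq_zero_iff moderate_const negligible_zero)

lemma cls_uminus:
  assumes "moderate_seq x" shows "cls (\<lambda>n. - x n) = \<ominus> cls x"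
proof -
  have "cls (\<lambda>n. - x n) \<oplus> cls x = \<zero>"
    using cls_add[OF moderate_uminus[OF assms] assms] cls_zero by simp
  then show ?thesis
    using assms by (simp add: minus_equality moderate_uminus)
qed

lemma cls_eq_iff:
  assumes "moderate_seq x" "moderate_seq y"
  shows "cls x = cls y \<longleftrightarrow> negligible_seq (\<lambda>n. x n - y n)"
proof -
  have "cls (\<lambda>n. x n - y n) = cls x \<ominus> cls y"
    using cls_add[OF assms(1) moderate_uminus[OF assms(2)]] assms
    by (simp add: cls_uminus a_minus_def)
  then have "cls x = cls y \<longleftrightarrow> cls (\<lambda>n. x n - y n) = \<zero>"
    using assms by (simp add: r_right_minus_eq)
  then show ?thesis
    using assms by (simp add: cls_eq_zero_iff moderate_diff)
qed

lemma cls_cong: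
  assumes "moderate_seq x" "moderate_seq y" "\<forall>\<^sub>F n in U. x n = y n"
  shows "cls x = cls y"
  using assms negligible_mono[OF negligible_zero, of "\<lambda>n. x n - y n"]
  by (simp add: cls_eq_iff)

lemma field_K: "field K"
proof (rule cring_fieldI2)
  show "\<zero> \<noteq> \<one>"
    unfolding cls_one[symmetric] cls_zero[symmetric]
    by (subst cls_eq_iff) (simp_all add: moderate_const negligible_const_iff)
  fix a assume "a \<in> carrier K" "a \<noteq> \<zero>"
  then obtain x where x: "moderate_seq x" "\<not> negligible_seq x" and a: "a = cls x"
    by (metis carrierE cls_eq_zero_iff)
  have inv: "moderate_seq (\<lambda>n. inverse (x n))" using x(2) by (rule moderate_inverse)
  have "a \<otimes> cls (\<lambda>n. inverse (x n)) = cls (\<lambda>n. x n * inverse (x n))"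
    using x inv by (simp add: a cls_mult)
  also have "\<dots> = cls (\<lambda>_. 1)"
    using x inv non_negligible_nonzero[OF x(2)]
    by (intro cls_cong moderate_mult moderate_const) (auto elim: eventually_mono)
  finally show "\<exists>b\<in>carrier K. a \<otimes> b = \<one>"
    using inv by (auto simp: cls_one)
qed

lemma cls_power:
  "moderate_seq x \<Longrightarrow> moderate_seq (\<lambda>n. x n ^ k) \<and> cls (\<lambda>n. x n ^ k) = cls x [^] k"
proof (induction k)
  case 0
  then show ?case by (simp add: moderate_const cls_one)
next
  case (Suc k)
  then show ?case
    by (simp add: moderate_mult cls_mult m_comm)
qed

text \<open>Evaluation of polynomials is levelwise. Polynomials over \<open>K\<close> list the leading coefficient
  first, those over \<open>'a\<close> the constant coefficient first; hence the reversal.\<close>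

lemma eval_cls:
  assumes "\<forall>x\<in>set xs. moderate_seq x" "moderate_seq y"
  shows "moderate_seq (\<lambda>n. poly (Poly (rev (map (\<lambda>x. x n) xs))) (y n)) \<and>
         eval (map cls xs) (cls y) = cls (\<lambda>n. poly (Poly (rev (map (\<lambda>x. x n) xs))) (y n))"
  using assms(1)
proof (induction xs)
  case Nil
  then show ?case by (simp add: moderate_const cls_zero)
next
  case (Cons x xs)
  then show ?case
    using assms(2) cls_power[OF assms(2), of "length xs"]
    by (simp add: Poly_snoc poly_monom moderate_add moderate_mult cls_add cls_mult a_comm)
qed

text \<open>The transfer principle for roots: the leading coefficients of the levelwise polynomials are
  nonzero almost everywhere, so that almost all of them have the degree of \<open>p\<close>, and the chosen roots
  form a moderate sequence by \<open>norm_root_le\<close>.\<close>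

lemma root_exists:
  assumes p: "p \<in> carrier (poly_ring K)" and deg: "0 < Polynomials.degree p"
    and roots: "\<And>q :: 'a poly. Polynomial.degree q = Polynomials.degree p \<Longrightarrow> \<exists>z. poly q z = 0"
  shows "\<exists>a\<in>carrier K. eval p a = \<zero>"
proof -
  have pol: "polynomial (carrier K) p" using p by (simp add: univ_poly_carrier)
  then have "set p \<subseteq> carrier K" by (rule polynomial_in_carrier[OF carrier_is_subring])
  then have "\<exists>ys. (\<forall>y\<in>set ys. moderate_seq y) \<and> p = map cls ys"
  proof (induction p)
    case (Cons a p)
    then obtain ys where "\<forall>y\<in>set ys. moderate_seq y" "p = map cls ys" by auto
    moreover obtain y where "moderate_seq y" "a = cls y"
      using Cons.prems carrierE[of a] by auto
    ultimately show ?case by (intro exI[of _ "y # ys"]) simp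
  qed simp
  then obtain ys where ys: "\<forall>y\<in>set ys. moderate_seq y" "p = map cls ys" by blast
  obtain x xs where ys_eq: "ys = x # xs" using deg ys(2) by (cases ys) auto
  have mod: "moderate_seq x" "\<forall>y\<in>set xs. moderate_seq y" using ys(1) by (auto simp: ys_eq)
  have "cls x \<noteq> \<zero>" using pol by (simp add: polynomial_def ys(2) ys_eq)
  then have neg: "\<not> negligible_seq x" using mod(1) by (simp add: cls_eq_zero_iff)
  define q where "q n = Poly (rev (map (\<lambda>y. y n) ys))" for n
  have deg_q: "Polynomial.degree (q n) = Polynomials.degree p" if "x n \<noteq> 0" for n
  proof (rule antisym)
    show "Polynomial.degree (q n) \<le> Polynomials.degree p"
      by (rule degree_le) (simp add: q_def ys(2) ys_eq nth_default_beyond)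
    have "Polynomial.coeff (q n) (length xs) = x n"
      by (simp add: q_def ys_eq nth_default_append)
    then show "Polynomials.degree p \<le> Polynomial.degree (q n)"
      using that by (simp add: ys(2) ys_eq le_degree)
  qed
  (* On the null set where the leading coefficient vanishes, 0 keeps the bound below valid. *)
  define y where "y n = (if x n = 0 then 0 else SOME z. poly (q n) z = 0)" for n
  have root: "poly (q n) (y n) = 0" if "x n \<noteq> 0" for n
    using that someI_ex[OF roots[OF deg_q[OF that]]] by (simp add: y_def)
  have "(\<lambda>n. \<Sum>y\<leftarrow>xs. norm (y n)) \<in> B"
    using mod(2) by (induction xs) (auto simp: moderate_seq_def bound_const intro: bound_add)
  then have "(\<lambda>n. 1 + (\<Sum>y\<leftarrow>xs. norm (y n)) * inverse (norm (x n))) \<in> B"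
    using moderate_inverse[OF neg]
    by (intro bound_add bound_mult bound_const) (auto simp: moderate_seq_def norm_inverse)
  moreover have "norm (y n) \<le> 1 + (\<Sum>y\<leftarrow>xs. norm (y n)) * inverse (norm (x n))" for n
  proof (cases "x n = 0")
    case False
    then show ?thesis
      using norm_root_le[of "x n" "map (\<lambda>y. y n) xs" "y n"] root[of n] 
      by (simp add: q_def ys_eq comp_def)
  qed (simp add: y_def)
  ultimately have y: "moderate_seq y" by (auto intro: moderate_seqI)
  have "eval p (cls y) = cls (\<lambda>n. poly (q n) (y n))"
    using eval_cls[OF ys(1) y] by (simp add: ys(2) q_def)
  also have "\<dots> = cls (\<lambda>_. 0)"
    using eval_cls[OF ys(1) y] non_negligible_nonzero[OF neg]
    by (intro cls_cong moderate_const) (auto simp: q_def[symmetric] root elim: eventually_mono)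
  finally show ?thesis using y by (auto simp: cls_zero)
qed

end

lemma (in sequence_model) cls_of_nat: "[k] \<cdot> \<one> = cls (\<lambda>_. of_nat k)"
proof (induction k)
  case 0
  then show ?case by (simp add: cls_zero)
next
  case (Suc k)
  have "cls (\<lambda>_. of_nat (Suc k)) = cls (\<lambda>_. of_nat k + 1)" by (simp add: add.commute)
  also have "\<dots> = cls (\<lambda>_. of_nat k) \<oplus> \<one>"
    by (simp add: cls_add moderate_const flip: cls_one)
  finally show ?case using Suc by simp
qed

section \<open>The ordered fields of real sequences\<close>

text \<open>The inequality \<open>cls x \<preceq> cls y\<close> means that the positive part of \<open>x - y\<close> is negligible; the
  axiom spells this out with thresholds.\<close>

locale ordered_sequence_model = sequence_model U B w K cls
  for U B w and K :: "('b, 'm) ring_scheme" (structure) and cls :: "(nat \<Rightarrow> real) \<Rightarrow> 'b" +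
  fixes leq :: "'b \<Rightarrow> 'b \<Rightarrow> bool" (infix "\<preceq>" 50)
  assumes leq_iff: "moderate_seq x \<Longrightarrow> moderate_seq y \<Longrightarrow>
    cls x \<preceq> cls y \<longleftrightarrow> (\<forall>m. \<forall>\<^sub>F n in U. x n \<le> y n + w m n)"
begin

lemma leqI:
  "moderate_seq x \<Longrightarrow> moderate_seq y \<Longrightarrow> \<forall>\<^sub>F n in U. x n \<le> y n \<Longrightarrow> cls x \<preceq> cls y"
  by (auto simp: leq_iff elim!: eventually_mono intro: add_increasing2 threshold_nonneg)

text \<open>A nonnegative element is represented by the positive part of any representative. This makes
  products and square roots of nonnegative elements levelwise.\<close>

lemma nonneg_representative:
  assumes "a \<in> carrier K" "\<zero> \<preceq> a"
  obtains x where "moderate_seq x" "\<And>n. 0 \<le> x n" "a = cls x"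
proof -
  obtain x where x: "moderate_seq x" and a: "a = cls x" using assms(1) by (rule carrierE)
  have pos: "moderate_seq (\<lambda>n. max 0 (x n))"
    using x by (intro moderate_seqI[of "\<lambda>n. norm (x n)"] always_eventually) (auto simp: moderate_seq_def)
  have ge: "\<forall>\<^sub>F n in U. 0 \<le> x n + w m n" for m
    using assms(2) x leq_iff[OF moderate_const x, of 0] by (simp add: a cls_zero)
  have "\<forall>\<^sub>F n in U. norm (x n - max 0 (x n)) \<le> w m n" for m
    using ge[of m] by eventually_elim (use threshold_nonneg[of m] in \<open>auto simp: max_def\<close>)
  then have "a = cls (\<lambda>n. max 0 (x n))"
    using x pos by (simp add: a cls_eq_iff negligible_seq_def)
  then show ?thesis using pos that by auto
qed

lemma ordered_field_K: "ordered_field K (\<preceq>)"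
proof (intro ordered_field.intro field_K ordered_field_axioms.intro)
  fix a assume "a \<in> carrier K"
  then show "a \<preceq> a" by (auto elim!: carrierE intro: leqI)
next
  fix a b assume "a \<in> carrier K" "b \<in> carrier K" and le: "a \<preceq> b" "b \<preceq> a"
  then obtain x y where x: "moderate_seq x" "a = cls x" and y: "moderate_seq y" "b = cls y"
    by (metis carrierE)
  have "\<forall>\<^sub>F n in U. norm (x n - y n) \<le> w m n" for m
  proof -
    have "\<forall>\<^sub>F n in U. x n \<le> y n + w m n" "\<forall>\<^sub>F n in U. y n \<le> x n + w m n"
      using le x y by (simp_all add: leq_iff)
    then show ?thesis by eventually_elim auto
  qed
  then show "a = b" using x y by (simp add: cls_eq_iff negligible_seq_def)
next
  fix a b c assume "a \<in> carrier K" "b \<in> carrier K" "c \<in> carrier K" and le: "a \<preceq> b" "b \<preceq> c"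
  then obtain x y z where x: "moderate_seq x" "a = cls x" and y: "moderate_seq y" "b = cls y"
    and z: "moderate_seq z" "c = cls z"
    by (metis carrierE)
  have "\<forall>\<^sub>F n in U. x n \<le> z n + w m n" for m
  proof -
    obtain k where "\<forall>\<^sub>F n in U. 2 * w k n \<le> w m n" using threshold_halve by blast
    moreover have "\<forall>\<^sub>F n in U. x n \<le> y n + w k n" "\<forall>\<^sub>F n in U. y n \<le> z n + w k n"
      using le x y z by (simp_all add: leq_iff)
    ultimately show ?thesis by eventually_elim auto
  qed
  then show "a \<preceq> c" using x z by (simp add: leq_iff)
next
  fix a b assume "a \<in> carrier K" "b \<in> carrier K"
  then obtain x y where x: "moderate_seq x" "a = cls x" and y: "moderate_seq y" "b = cls y"
    by (metis carrierE)
  show "a \<preceq> b \<or> b \<preceq> a"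
  proof (cases "\<forall>\<^sub>F n in U. x n \<le> y n")
    case True
    then show ?thesis using x y by (auto intro: leqI)
  next
    case False
    then have "\<forall>\<^sub>F n in U. y n \<le> x n" by (auto dest!: eventually_not elim!: eventually_mono)
    then show ?thesis using x y by (auto intro: leqI)
  qed
next
  fix a b c assume "a \<in> carrier K" "b \<in> carrier K" "c \<in> carrier K" and le: "a \<preceq> b"
  then obtain x y z where x: "moderate_seq x" "a = cls x" and y: "moderate_seq y" "b = cls y"
    and z: "moderate_seq z" "c = cls z"
    by (metis carrierE)
  have "\<forall>m. \<forall>\<^sub>F n in U. x n \<le> y n + w m n" using le x y by (simp add: leq_iff)
  then have "cls (\<lambda>n. x n + z n) \<preceq> cls (\<lambda>n. y n + z n)"
    using x y z by (simp add: leq_iff moderate_add algebra_simps)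
  then show "a \<oplus> c \<preceq> b \<oplus> c" using x y z by (simp add: cls_add)
next
  fix a b assume "a \<in> carrier K" "b \<in> carrier K" "\<zero> \<preceq> a" "\<zero> \<preceq> b"
  then obtain x y where x: "moderate_seq x" "\<And>n. 0 \<le> x n" "a = cls x"
    and y: "moderate_seq y" "\<And>n. 0 \<le> y n" "b = cls y"
    by (metis nonneg_representative)
  then have "cls (\<lambda>_. 0) \<preceq> cls (\<lambda>n. x n * y n)"
    by (intro leqI moderate_mult moderate_const) auto
  then show "\<zero> \<preceq> a \<otimes> b" using x y by (simp add: cls_mult cls_zero)
qed

lemma real_closed_field_K: "real_closed_field K (\<preceq>)"
proof (intro real_closed_field.intro ordered_field_K real_closed_field_axioms.intro)
  fix a assume "a \<in> carrier K" "\<zero> \<preceq> a"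
  then obtain x where x: "moderate_seq x" "\<And>n. 0 \<le> x n" "a = cls x"
    by (metis nonneg_representative)
  have "cls (\<lambda>n. sqrt (x n)) \<otimes> cls (\<lambda>n. sqrt (x n)) = a"
    using x by (simp add: moderate_sqrt flip: cls_mult)
  then show "\<exists>b\<in>carrier K. b \<otimes> b = a" using x moderate_sqrt cls_closed by blast
next
  fix p assume "p \<in> carrier (poly_ring K)" and deg: "odd (Polynomials.degree p)"
  moreover have "0 < Polynomials.degree p" using deg by (rule odd_pos)
  ultimately show "\<exists>a\<in>carrier K. eval p a = \<zero>"
    by (metis root_exists odd_degree_real_poly_root)
qed

text \<open>The class of the identity sequence is infinitely large.\<close>

lemma not_archimedean_K: "\<not> archimedean K (\<preceq>)"
proof
  assume "archimedean K (\<preceq>)"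
  moreover have omega: "moderate_seq real" by (simp add: moderate_seq_def bound_real)
  ultimately obtain k where "cls real \<preceq> cls (\<lambda>_. real k)"
    unfolding archimedean_def cls_of_nat by (meson cls_closed)
  then have "\<forall>\<^sub>F n in U. real n \<le> real k + w 0 n"
    using omega by (simp add: leq_iff moderate_const)
  moreover have "\<forall>\<^sub>F n in U. k + 2 \<le> n" by (rule eventually_ge)
  ultimately have "\<forall>\<^sub>F n in U. False"
  proof eventually_elim
    case (elim n)
    then show ?case using threshold_le_1[of 0 n] by linarith
  qed
  then show False using nontrivial by simp
qed

lemma leq_const_iff: "cls (\<lambda>_. r) \<preceq> cls (\<lambda>_. s) \<longleftrightarrow> r \<le> s"
proof
  assume le: "cls (\<lambda>_. r) \<preceq> cls (\<lambda>_. s)"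
  show "r \<le> s"
  proof (rule ccontr)
    assume "\<not> r \<le> s"
    then have "negligible_seq (\<lambda>_. r - s)"
      using le by (simp add: leq_iff moderate_const negligible_seq_def algebra_simps)
    then show False using \<open>\<not> r \<le> s\<close> by (simp add: negligible_const_iff)
  qed
qed (simp add: leqI moderate_const)

lemma ordered_embedding_reals: "ordered_embedding real_ring (\<le>) K (\<preceq>) (\<lambda>r. cls (\<lambda>_. r))"
  unfolding ordered_embedding_def
  by (auto intro!: ring_hom_memI inj_onI
      simp: ring_of_type_algebra_def moderate_const cls_add cls_mult cls_one leq_const_iff
        cls_eq_iff negligible_const_iff)

text \<open>The diagonal argument. Representatives of the endpoints may violate the inequalities between them by
  negligible amounts, so the first \<open>m\<close> of them are only required up to the error \<open>w m\<close>, which becomes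
  negligible as \<open>m\<close> grows with the level.\<close>

lemma cantor_complete_K: "cantor_complete K (\<preceq>)"
  unfolding cantor_complete_def
proof (intro allI impI, elim conjE)
  fix a b :: "nat \<Rightarrow> 'b"
  assume ab: "\<forall>n. a n \<in> carrier K \<and> b n \<in> carrier K \<and> a n \<preceq> b n"
    and nested: "\<forall>n. closed_interval K (\<preceq>) (a (Suc n)) (b (Suc n)) \<subseteq> closed_interval K (\<preceq>) (a n) (b n)"
  interpret ordered_field K "(\<preceq>)" by (rule ordered_field_K)
  have mem: "a n \<in> closed_interval K (\<preceq>) (a n) (b n)" "b n \<in> closed_interval K (\<preceq>) (a n) (b n)" for n
    using ab by (auto simp: closed_interval_def le_refl)
  have sub: "closed_interval K (\<preceq>) (a j) (b j) \<subseteq> closed_interval K (\<preceq>) (a i) (b i)" if "i \<le> j" for i j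
    using lift_Suc_antimono_le[of "\<lambda>n. closed_interval K (\<preceq>) (a n) (b n)"] nested that by blast
  have cross: "a i \<preceq> b j" for i j
  proof (cases "i \<le> j")
    case True
    then have "b j \<in> closed_interval K (\<preceq>) (a i) (b i)" using sub mem(2) by blast
    then show ?thesis by (simp add: closed_interval_def)
  next
    case False
    then have "a i \<in> closed_interval K (\<preceq>) (a j) (b j)" using sub[of j i] mem(1) by auto
    then show ?thesis by (simp add: closed_interval_def)
  qed
  have "\<forall>i. \<exists>x. moderate_seq x \<and> a i = cls x" "\<forall>i. \<exists>y. moderate_seq y \<and> b i = cls y"
    using ab by (meson carrierE)+
  then obtain x y where x: "\<And>i. moderate_seq (x i)" "\<And>i. a i = cls (x i)"
    and y: "\<And>i. moderate_seq (y i)" "\<And>i. b i = cls (y i)"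
    by metis
  (* M n is the stage reached at level n; the bound by n makes the greatest stage exist. *)
  define P where "P m n \<longleftrightarrow> (\<forall>i\<le>m. \<forall>j\<le>m. x i n \<le> y j n + w m n)" for m n
  define M where "M n = (GREATEST m. m \<le> n \<and> P m n)" for n
  have P_ev: "\<forall>\<^sub>F n in U. P m n" for m
  proof -
    have "\<forall>\<^sub>F n in U. x i n \<le> y j n + w m n" for i j
      using cross[of i j] by (simp add: x y leq_iff)
    then have "\<forall>\<^sub>F n in U. \<forall>i\<in>{..m}. \<forall>j\<in>{..m}. x i n \<le> y j n + w m n"
      by (intro eventually_ball_finite ballI) auto
    then show ?thesis by (rule eventually_mono) (simp add: P_def)
  qed
  have M_ev: "\<forall>\<^sub>F n in U. m \<le> M n \<and> P (M n) n" for m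
    using eventually_ge[of m] P_ev[of m]
  proof eventually_elim
    case (elim n)
    then have "m \<le> n \<and> P m n" by simp
    then show ?case
      unfolding M_def
      using GreatestI_nat[of "\<lambda>m. m \<le> n \<and> P m n" m n] Greatest_le_nat[of "\<lambda>m. m \<le> n \<and> P m n" m n]
      by blast
  qed
  define s where "s n = Max ((\<lambda>i. x i n) ` {..M n})" for n
  have lower: "\<forall>\<^sub>F n in U. x i n \<le> s n" for i
    using M_ev[of i] by (rule eventually_mono) (auto simp: s_def)
  have upper: "\<forall>\<^sub>F n in U. s n \<le> y j n + w m n" for j m
    using M_ev[of "max j m"]
  proof eventually_elim
    case (elim n)
    have "x i n \<le> y j n + w m n" if "i \<le> M n" for i
    proof -
      have "x i n \<le> y j n + w (M n) n" using elim that by (simp add: P_def)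
      also have "w (M n) n \<le> w m n" using elim by (simp add: threshold_antimono)
      finally show ?thesis by simp
    qed
    then show ?case by (simp add: s_def)
  qed
  have s: "moderate_seq s"
  proof (rule moderate_seqI)
    show "(\<lambda>n. norm (x 0 n) + (norm (y 0 n) + 1)) \<in> B"
      using x y by (intro bound_add bound_const) (auto simp: moderate_seq_def)
    show "\<forall>\<^sub>F n in U. norm (s n) \<le> norm (x 0 n) + (norm (y 0 n) + 1)"
      using lower[of 0] upper[of 0 0]
    proof eventually_elim
      case (elim n)
      then show ?case using threshold_le_1[of 0 n] unfolding real_norm_def by linarith
    qed
  qed
  have "a i \<preceq> cls s" "cls s \<preceq> b i" for i
    using s x y lower upper leqI by (auto simp: leq_iff[of s])
  then have "cls s \<in> (\<Inter>n. closed_interval K (\<preceq>) (a n) (b n))"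
    using s by (simp add: closed_interval_def)
  then show "(\<Inter>n. closed_interval K (\<preceq>) (a n) (b n)) \<noteq> {}" by blast
qed

end

section \<open>The complex fields\<close>

lemma algebraically_closed_complex_model:
  fixes cls :: "(nat \<Rightarrow> complex) \<Rightarrow> 'b"
  assumes "sequence_model U B w K cls"
  shows "algebraically_closed K"
proof -
  interpret sequence_model U B w K cls by fact
  interpret field K by (rule field_K)
  show ?thesis
  proof (rule algebraically_closedI)
    fix p assume "p \<in> carrier (poly_ring K)" "1 < Polynomials.degree p"
    then show "\<exists>a\<in>carrier K. eval p a = \<zero>\<^bsub>K\<^esub>"
      by (intro root_exists complex_poly_root) auto
  qed
qed

lemma complexification_of_models:
  fixes clsR :: "(nat \<Rightarrow> real) \<Rightarrow> 'b" and clsC :: "(nat \<Rightarrow> complex) \<Rightarrow> 'c"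
  assumes R: "sequence_model U B w R clsR" and C: "sequence_model U B w C clsC"
    and e: "\<And>x. growth_scale.moderate_seq B x \<Longrightarrow> e (clsR x) = clsC (\<lambda>n. complex_of_real (x n))"
  shows "is_complexification R C e (clsC (\<lambda>_. \<i>))"
proof -
  interpret R: sequence_model U B w R clsR by fact
  interpret C: sequence_model U B w C clsC by fact
  have e_cls: "e (clsR x) = clsC (\<lambda>n. complex_of_real (x n))" if "R.moderate_seq x" for x
    using that by (simp add: e)
  have mod: "R.moderate_seq (\<lambda>n. complex_of_real (x n)) \<longleftrightarrow> R.moderate_seq x" for x
    by (simp add: R.moderate_seq_def)
  have hom: "e \<in> ring_hom R C"
  proof (rule ring_hom_memI)
    fix a b assume "a \<in> carrier R" "b \<in> carrier R"
    then obtain x y where x: "R.moderate_seq x" "a = clsR x" and y: "R.moderate_seq y" "b = clsR y"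
      by (metis R.carrierE)
    show "e (a \<otimes>\<^bsub>R\<^esub> b) = e a \<otimes>\<^bsub>C\<^esub> e b" "e (a \<oplus>\<^bsub>R\<^esub> b) = e a \<oplus>\<^bsub>C\<^esub> e b"
      using x y
      by (simp_all add: e_cls mod R.moderate_mult R.moderate_add
          flip: R.cls_mult R.cls_add C.cls_mult C.cls_add)
  next
    fix a assume "a \<in> carrier R"
    then show "e a \<in> carrier C" by (auto elim!: R.carrierE simp: e_cls mod)
  next
    show "e \<one>\<^bsub>R\<^esub> = \<one>\<^bsub>C\<^esub>"
      by (simp add: e_cls R.moderate_const C.cls_one flip: R.cls_one)
  qed
  have inj: "inj_on e (carrier R)"
  proof (rule inj_onI)
    fix a b assume "a \<in> carrier R" "b \<in> carrier R" and eq: "e a = e b"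
    then obtain x y where x: "R.moderate_seq x" "a = clsR x" and y: "R.moderate_seq y" "b = clsR y"
      by (metis R.carrierE)
    have "R.negligible_seq (\<lambda>n. complex_of_real (x n) - complex_of_real (y n))"
      using x y eq by (simp add: e_cls mod C.cls_eq_iff)
    then show "a = b"
      using x y by (simp add: R.cls_eq_iff R.negligible_seq_def flip: of_real_diff)
  qed
  have i: "R.moderate_seq (\<lambda>_. \<i>)" by (rule R.moderate_const)
  have square: "clsC (\<lambda>_. \<i>) \<otimes>\<^bsub>C\<^esub> clsC (\<lambda>_. \<i>) = \<ominus>\<^bsub>C\<^esub> \<one>\<^bsub>C\<^esub>"
    by (simp add: i R.moderate_const flip: C.cls_mult C.cls_one C.cls_uminus)
  have decomp: "e (clsR x) \<oplus>\<^bsub>C\<^esub> clsC (\<lambda>_. \<i>) \<otimes>\<^bsub>C\<^esub> e (clsR y) = clsC (\<lambda>n. Complex (x n) (y n))"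
    if "R.moderate_seq x" "R.moderate_seq y" for x y
    using that i by (simp add: e_cls mod R.moderate_mult Complex_eq flip: C.cls_mult C.cls_add)
  have "carrier C = {e a \<oplus>\<^bsub>C\<^esub> clsC (\<lambda>_. \<i>) \<otimes>\<^bsub>C\<^esub> e b | a b. a \<in> carrier R \<and> b \<in> carrier R}"
  proof (intro equalityI subsetI)
    fix c assume "c \<in> carrier C"
    then obtain z where z: "R.moderate_seq z" "c = clsC z" by (rule C.carrierE)
    have parts: "R.moderate_seq (\<lambda>n. Re (z n))" "R.moderate_seq (\<lambda>n. Im (z n))"
      using z(1)
      by (auto simp: R.moderate_seq_def abs_Re_le_cmod abs_Im_le_cmod intro: R.bound_mono)
    show "c \<in> {e a \<oplus>\<^bsub>C\<^esub> clsC (\<lambda>_. \<i>) \<otimes>\<^bsub>C\<^esub> e b | a b. a \<in> carrier R \<and> b \<in> carrier R}"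
      by (rule CollectI, rule exI[of _ "clsR (\<lambda>n. Re (z n))"], rule exI[of _ "clsR (\<lambda>n. Im (z n))"])
        (simp add: decomp parts z(2))
  next
    fix c assume "c \<in> {e a \<oplus>\<^bsub>C\<^esub> clsC (\<lambda>_. \<i>) \<otimes>\<^bsub>C\<^esub> e b | a b. a \<in> carrier R \<and> b \<in> carrier R}"
    then show "c \<in> carrier C"
      using ring_hom_closed[OF hom] i by auto
  qed
  then show ?thesis
    unfolding is_complexification_def using hom inj square C.cls_closed[OF i] by blast
qed

section \<open>The fields of all sequences modulo equality almost everywhere\<close>

text \<open>Closure under negation comes for free, as multiplication by \<open>- 1\<close>.\<close>

lemma (in cring) idealI_cring:
  assumes "I \<subseteq> carrier R" "\<zero> \<in> I"
    and add: "\<And>a b. a \<in> I \<Longrightarrow> b \<in> I \<Longrightarrow> a \<oplus> b \<in> I"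
    and mult: "\<And>a x. a \<in> I \<Longrightarrow> x \<in> carrier R \<Longrightarrow> x \<otimes> a \<in> I"
  shows "ideal I R"
proof (rule idealI)
  show "subgroup I (add_monoid R)"
  proof (rule subgroup.intro)
    fix a assume a: "a \<in> I"
    then have "\<ominus> a = \<ominus> \<one> \<otimes> a" using assms(1) by (auto simp: l_minus)
    then have "\<ominus> a \<in> I" using mult[OF a, of "\<ominus> \<one>"] by simp
    then show "inv\<^bsub>add_monoid R\<^esub> a \<in> I" by (simp add: a_inv_def)
  qed (use assms in auto)
  show "a \<otimes> x \<in> I" if "a \<in> I" "x \<in> carrier R" for a x
    using mult[OF that] assms(1) that by (auto simp: m_comm)
qed (use assms in \<open>auto simp: ring_axioms\<close>)

lemma seq_ring_simps [simp]:
  "carrier seq_ring = UNIV"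
  "x \<otimes>\<^bsub>seq_ring\<^esub> y = (\<lambda>n. x n * y n)"
  "x \<oplus>\<^bsub>seq_ring\<^esub> y = (\<lambda>n. x n + y n)"
  "\<one>\<^bsub>seq_ring\<^esub> = (\<lambda>_. 1)"
  "\<zero>\<^bsub>seq_ring\<^esub> = (\<lambda>_. 0)"
  by (simp_all add: seq_ring_def)

lemma cring_seq_ring: "cring (seq_ring :: (nat \<Rightarrow> 'a::comm_ring_1) ring)"
proof (rule cringI)
  have "\<exists>y. (\<lambda>n. y n + x n) = (\<lambda>_. 0)" for x :: "nat \<Rightarrow> 'a"
    by (rule exI[of _ "\<lambda>n. - x n"]) simp
  then show "abelian_group (seq_ring :: (nat \<Rightarrow> 'a) ring)"
    by (intro abelian_groupI) (auto simp: algebra_simps)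
  show "comm_monoid (seq_ring :: (nat \<Rightarrow> 'a) ring)"
    by (rule comm_monoidI) (auto simp: algebra_simps)
qed (simp add: algebra_simps)

lemma ideal_null_seqs: "ideal (null_seqs U) (seq_ring :: (nat \<Rightarrow> 'a::comm_ring_1) ring)"
proof -
  interpret cring "seq_ring :: (nat \<Rightarrow> 'a) ring" by (rule cring_seq_ring)
  show ?thesis
  proof (rule idealI_cring)
    fix a b :: "nat \<Rightarrow> 'a" assume "a \<in> null_seqs U" "b \<in> null_seqs U"
    then have "\<forall>\<^sub>F n in U. a n = 0" "\<forall>\<^sub>F n in U. b n = 0" by (simp_all add: null_seqs_def)
    then have "\<forall>\<^sub>F n in U. a n + b n = 0" by eventually_elim simp
    then show "a \<oplus>\<^bsub>seq_ring\<^esub> b \<in> null_seqs U" by (simp add: null_seqs_def)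
  qed (auto simp: null_seqs_def elim: eventually_mono)
qed

lemma mem_star_iff: "y \<in> star U x \<longleftrightarrow> (\<forall>\<^sub>F n in U. y n = x n)"
proof
  assume "y \<in> star U x"
  then obtain z where "z \<in> null_seqs U" "y = (\<lambda>n. z n + x n)"
    by (auto simp: star_def a_r_coset_def r_coset_def)
  then show "\<forall>\<^sub>F n in U. y n = x n" by (auto simp: null_seqs_def)
next
  assume "\<forall>\<^sub>F n in U. y n = x n"
  then have "(\<lambda>n. y n - x n) \<in> null_seqs U" by (simp add: null_seqs_def)
  then show "y \<in> star U x"
    by (force simp: star_def a_r_coset_def r_coset_def)
qed

lemma star_self: "x \<in> star U x"
  by (simp add: mem_star_iff)

lemma star_eqI:
  assumes "\<forall>\<^sub>F n in U. x n = y n" shows "star U x = star U y"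
proof -
  have "(\<forall>\<^sub>F n in U. z n = x n) \<longleftrightarrow> (\<forall>\<^sub>F n in U. z n = y n)" for z
    by (rule eventually_subst) (use assms in \<open>auto elim: eventually_mono\<close>)
  then show ?thesis by (auto simp: mem_star_iff)
qed

lemma UNION_eq_const:
  assumes "a \<in> A" "\<And>x. x \<in> A \<Longrightarrow> f x = c" shows "(\<Union>x\<in>A. f x) = c"
  using assms by auto

lemma star_map_star: "star_map U f (star U x) = star U (\<lambda>n. f (x n))"
  unfolding star_map_def
  by (rule UNION_eq_const[OF star_self star_eqI])
    (auto simp: mem_star_iff elim: eventually_mono)

lemma star_map2_star: "star_map2 U f (star U x) (star U y) = star U (\<lambda>n. f (x n) (y n))"
  unfolding star_map2_def
  by (rule UNION_eq_const[OF star_self] UNION_eq_const[OF star_self star_eqI])+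
    (auto simp: mem_star_iff elim: eventually_elim2)

lemma star_le_star: "star_le U (star U x) (star U y) \<longleftrightarrow> (\<forall>\<^sub>F n in U. x n \<le> y n)"
proof
  assume "star_le U (star U x) (star U y)"
  then obtain x' y' where "\<forall>\<^sub>F n in U. x' n = x n" "\<forall>\<^sub>F n in U. y' n = y n" "\<forall>\<^sub>F n in U. x' n \<le> y' n"
    by (auto simp: star_le_def mem_star_iff)
  then show "\<forall>\<^sub>F n in U. x n \<le> y n" by eventually_elim simp
qed (use star_self in \<open>auto simp: star_le_def\<close>)

lemma growth_scale_all:
  "free_ultrafilter U \<Longrightarrow> growth_scale U UNIV (\<lambda>_ _. 0)"
  by unfold_locales auto

lemma sequence_model_star:
  assumes "free_ultrafilter U"
  shows "sequence_model U UNIV (\<lambda>_ _. 0) (star_field U) (star U :: (nat \<Rightarrow> 'a::real_normed_field) \<Rightarrow> _)"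
proof -
  interpret growth_scale U UNIV "\<lambda>_ _. 0" using assms by (rule growth_scale_all)
  interpret I: ideal "null_seqs U" "seq_ring :: (nat \<Rightarrow> 'a) ring" by (rule ideal_null_seqs)
  have star_eq: "star U = (+>\<^bsub>seq_ring\<^esub>) (null_seqs U :: (nat \<Rightarrow> 'a) set)"
    by (rule ext) (simp add: star_def)
  have hom: "star U \<in> ring_hom (seq_ring :: (nat \<Rightarrow> 'a) ring) (star_field U)"
    unfolding star_eq star_field_def by (rule I.rcos_ring_hom)
  interpret Q: cring "star_field U :: (nat \<Rightarrow> 'a) set ring"
    unfolding star_field_def by (rule I.quotient_is_cring[OF cring_seq_ring])
  have zero: "\<zero>\<^bsub>star_field U\<^esub> = star U (\<lambda>_. 0 :: 'a)"
    by (auto simp: star_field_def FactRing_def mem_star_iff null_seqs_def)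
  show ?thesis
  proof
    show "carrier (star_field U) = star U ` Collect (moderate_seq :: (nat \<Rightarrow> 'a) \<Rightarrow> bool)"
      by (auto simp: star_field_def FactRing_def A_RCOSETS_def' moderate_seq_def star_eq)
    fix x y :: "nat \<Rightarrow> 'a"
    show "star U (\<lambda>n. x n + y n) = star U x \<oplus>\<^bsub>star_field U\<^esub> star U y"
      "star U (\<lambda>n. x n * y n) = star U x \<otimes>\<^bsub>star_field U\<^esub> star U y"
      using ring_hom_add[OF hom, of x y] ring_hom_mult[OF hom, of x y] by simp_all
    show "star U (\<lambda>_. 1 :: 'a) = \<one>\<^bsub>star_field U\<^esub>" 
      using ring_hom_one[OF hom] by simp
    show "star U x = \<zero>\<^bsub>star_field U\<^esub> \<longleftrightarrow> negligible_seq x"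
      unfolding zero using star_self[of x U] star_eqI[of x "\<lambda>_. 0" U]
      by (auto simp: mem_star_iff negligible_seq_def)
  qed
qed

lemma ordered_sequence_model_star:
  assumes "free_ultrafilter U"
  shows "ordered_sequence_model U UNIV (\<lambda>_ _. 0) (star_real U) (star U) (star_le U)"
  by (intro ordered_sequence_model.intro sequence_model_star[OF assms]
      ordered_sequence_model_axioms.intro) (simp add: star_le_star)

section \<open>The fields of moderate elements modulo negligible ones\<close>

text \<open>Moderate and negligible elements are the classes of moderate and negligible sequences. So the
  former are a subring with the latter as an ideal, and the composite of the two quotient maps is
  the class map of a sequence model.\<close>

lemma sequence_model_rho:
  assumes scale: "growth_scale U B w"
    and moderate: "\<And>x :: nat \<Rightarrow> 'a::real_normed_field.
      star U x \<in> moderate U E \<longleftrightarrow> growth_scale.moderate_seq B x"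
    and negligible: "\<And>x :: nat \<Rightarrow> 'a.
      star U x \<in> negligible U E \<longleftrightarrow> growth_scale.negligible_seq U w x"
  shows "sequence_model U B w (rho_field U E) (\<lambda>x :: nat \<Rightarrow> 'a. rho_class U E (star U x))"
proof -
  interpret growth_scale U B w by (rule scale)
  interpret star: sequence_model U UNIV "\<lambda>_ _. 0" "star_field U" "star U :: (nat \<Rightarrow> 'a) \<Rightarrow> _"
    using free_ultrafilter by (rule sequence_model_star)
  define S where "S = (star_field U)\<lparr>carrier := moderate U E :: (nat \<Rightarrow> 'a) set set\<rparr>"
  have any: "star.moderate_seq x" for x :: "nat \<Rightarrow> 'a" by (simp add: star.moderate_seq_def)
  have S_simps [simp]: "carrier S = moderate U E" "(\<otimes>\<^bsub>S\<^esub>) = (\<otimes>\<^bsub>star_field U\<^esub>)" "(\<oplus>\<^bsub>S\<^esub>) = (\<oplus>\<^bsub>star_field U\<^esub>)"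
    "\<one>\<^bsub>S\<^esub> = \<one>\<^bsub>star_field U\<^esub>" "\<zero>\<^bsub>S\<^esub> = \<zero>\<^bsub>star_field U\<^esub>"
    by (simp_all add: S_def)
  note hom = star.cls_add[OF any any, symmetric] star.cls_mult[OF any any, symmetric]
    star.cls_uminus[OF any, symmetric] star.cls_one[symmetric] star.cls_zero[symmetric]
  have moderate_eq: "moderate U E = star U ` Collect (moderate_seq :: (nat \<Rightarrow> 'a) \<Rightarrow> bool)"
  proof (intro equalityI subsetI)
    fix A :: "(nat \<Rightarrow> 'a) set" assume A: "A \<in> moderate U E"
    then obtain x where "A = star U x" by (auto simp: moderate_def star.carrier_eq)
    then show "A \<in> star U ` Collect moderate_seq" using A by (auto simp: moderate)
  qed (auto simp: moderate)
  have negligible_eq: "negligible U E = star U ` Collect (negligible_seq :: (nat \<Rightarrow> 'a) \<Rightarrow> bool)"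
  proof (intro equalityI subsetI)
    fix A :: "(nat \<Rightarrow> 'a) set" assume A: "A \<in> negligible U E"
    then obtain x where "A = star U x" by (auto simp: negligible_def star.carrier_eq)
    then show "A \<in> star U ` Collect negligible_seq" using A by (auto simp: negligible)
  qed (auto simp: negligible)
  have "subring (moderate U E) (star_field U :: (nat \<Rightarrow> 'a) set ring)"
  proof (rule star.subringI)
    show "moderate U E \<subseteq> carrier (star_field U :: (nat \<Rightarrow> 'a) set ring)" by (auto simp: moderate_def)
  qed (auto simp: moderate_eq hom
        intro!: imageI moderate_const moderate_uminus moderate_add moderate_mult)
  then interpret S: cring S
    unfolding S_def by (intro star.subcring_iff[THEN iffD1] star.subcringI') (auto simp: moderate_def)
  interpret I: ideal "negligible U E" S
    by (rule S.idealI_cring)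
      (auto simp: negligible_eq moderate_eq hom
        intro!: imageI negligible_moderate negligible_zero negligible_add negligible_mult)
  have class_eq: "rho_class U E = (+>\<^bsub>S\<^esub>) (negligible U E :: (nat \<Rightarrow> 'a) set set)"
    by (rule ext) (simp add: rho_class_def a_r_coset_def r_coset_def)
  have field_eq: "rho_field U E = S Quot (negligible U E :: (nat \<Rightarrow> 'a) set set)"
    by (simp add: rho_field_def S_def)
  have class_hom: "rho_class U E \<in> ring_hom S (rho_field U E)"
    unfolding class_eq field_eq by (rule I.rcos_ring_hom)
  have mem: "star U x \<in> carrier S" if "moderate_seq x" for x :: "nat \<Rightarrow> 'a"
    using that by (simp add: moderate)
  interpret Q: cring "rho_field U E :: (nat \<Rightarrow> 'a) set set ring"
    unfolding field_eq by (rule I.quotient_is_cring) (rule S.is_cring)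
  show ?thesis
  proof
    show "carrier (rho_field U E) = (\<lambda>x. rho_class U E (star U x)) ` Collect (moderate_seq :: (nat \<Rightarrow> 'a) \<Rightarrow> bool)"
      by (auto simp: field_eq class_eq FactRing_def A_RCOSETS_def' moderate_eq)
    fix x y :: "nat \<Rightarrow> 'a" assume x: "moderate_seq x"
    show "rho_class U E (star U (\<lambda>n. x n + y n))
        = rho_class U E (star U x) \<oplus>\<^bsub>rho_field U E\<^esub> rho_class U E (star U y)"
      "rho_class U E (star U (\<lambda>n. x n * y n))
        = rho_class U E (star U x) \<otimes>\<^bsub>rho_field U E\<^esub> rho_class U E (star U y)"
      if y: "moderate_seq y"
      using ring_hom_add[OF class_hom mem[OF x] mem[OF y]] ring_hom_mult[OF class_hom mem[OF x] mem[OF y]]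
      by (simp_all add: hom)
    have "rho_class U E (star U x) = \<zero>\<^bsub>rho_field U E\<^esub> \<longleftrightarrow> star U x \<in> negligible U E"
      using I.a_rcos_const[of "star U x"] I.a_rcos_self[OF mem[OF x]]
      by (auto simp: class_eq field_eq FactRing_def)
    then show "rho_class U E (star U x) = \<zero>\<^bsub>rho_field U E\<^esub> \<longleftrightarrow> negligible_seq x"
      by (simp add: negligible)
  next
    show "rho_class U E (star U (\<lambda>_. 1 :: 'a)) = \<one>\<^bsub>rho_field U E\<^esub>"
      using ring_hom_one[OF class_hom] by (simp add: hom)
  qed
qed

lemma mem_rho_class_iff:
  assumes ultra: "free_ultrafilter U"
    and negligible: "\<And>x :: nat \<Rightarrow> 'a::real_normed_field.
      star U x \<in> negligible U E \<longleftrightarrow> growth_scale.negligible_seq U w x"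
  shows "A \<in> rho_class U E (star U x) \<longleftrightarrow>
    (\<exists>z :: nat \<Rightarrow> 'a. growth_scale.negligible_seq U w z \<and> A = star U (\<lambda>n. z n + x n))"
proof -
  interpret star: sequence_model U UNIV "\<lambda>_ _. 0" "star_field U" "star U :: (nat \<Rightarrow> 'a) \<Rightarrow> _"
    using ultra by (rule sequence_model_star)
  have any: "star.moderate_seq x" for x :: "nat \<Rightarrow> 'a" by (simp add: star.moderate_seq_def)
  have "A \<in> rho_class U E (star U x) \<longleftrightarrow>
      (\<exists>C\<in>negligible U E. A = C \<oplus>\<^bsub>star_field U\<^esub> star U x)"
    by (auto simp: rho_class_def a_r_coset_def r_coset_def)
  also have "\<dots> \<longleftrightarrow> (\<exists>z. star U z \<in> negligible U E \<and> A = star U z \<oplus>\<^bsub>star_field U\<^esub> star U x)"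
    by (auto simp: negligible_def star.carrier_eq any)
  finally show ?thesis by (simp add: negligible star.cls_add[OF any any])
qed

text \<open>An inequality between some representatives gives one between given sequences up to
  negligible terms, whose difference is below every threshold; conversely the positive part of
  \<open>x - y\<close> is the negligible correction of the right-hand side.\<close>

lemma ordered_sequence_model_rho:
  assumes scale: "growth_scale U B w"
    and moderate: "\<And>x :: nat \<Rightarrow> real. star U x \<in> moderate U E \<longleftrightarrow> growth_scale.moderate_seq B x"
    and negligible: "\<And>x :: nat \<Rightarrow> real. star U x \<in> negligible U E \<longleftrightarrow> growth_scale.negligible_seq U w x"
  shows "ordered_sequence_model U B w (rho_real U E) (\<lambda>x. rho_class U E (star U x)) (rho_le U)"
proof (intro ordered_sequence_model.intro sequence_model_rho[OF assms] ordered_sequence_model_axioms.intro)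
  interpret growth_scale U B w by (rule scale)
  fix x y :: "nat \<Rightarrow> real"
  have "rho_le U (rho_class U E (star U x)) (rho_class U E (star U y)) \<longleftrightarrow>
      (\<exists>z z'. negligible_seq z \<and> negligible_seq z' \<and>
        star_le U (star U (\<lambda>n. z n + x n)) (star U (\<lambda>n. z' n + y n)))"
    unfolding rho_le_def Bex_def mem_rho_class_iff[OF free_ultrafilter negligible] by blast
  also have "\<dots> \<longleftrightarrow>
      (\<exists>z z'. negligible_seq z \<and> negligible_seq z' \<and> (\<forall>\<^sub>F n in U. z n + x n \<le> z' n + y n))"
    by (simp add: star_le_star)
  also have "\<dots> \<longleftrightarrow> (\<forall>m. \<forall>\<^sub>F n in U. x n \<le> y n + w m n)"
  proof (safe)
    fix z z' m assume z: "negligible_seq z" "negligible_seq z'" and le: "\<forall>\<^sub>F n in U. z n + x n \<le> z' n + y n"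
    have "negligible_seq (\<lambda>n. z' n + - z n)"
      using z by (intro negligible_add) (simp_all add: negligible_uminus_iff)
    then have "\<forall>\<^sub>F n in U. norm (z' n + - z n) \<le> w m n" by (simp add: negligible_seq_def)
    with le show "\<forall>\<^sub>F n in U. x n \<le> y n + w m n" by eventually_elim simp
  next
    assume le: "\<forall>m. \<forall>\<^sub>F n in U. x n \<le> y n + w m n"
    have z': "negligible_seq (\<lambda>n. max 0 (x n - y n))"
      unfolding negligible_seq_def
    proof
      fix m
      show "\<forall>\<^sub>F n in U. norm (max 0 (x n - y n)) \<le> w m n"
        using le[rule_format, of m] by eventually_elim (use threshold_nonneg[of m] in auto)
    qed
    show "\<exists>z z'. negligible_seq z \<and> negligible_seq z' \<and> (\<forall>\<^sub>F n in U. z n + x n \<le> z' n + y n)"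
      by (rule exI[of _ "\<lambda>_. 0"], rule exI[of _ "\<lambda>n. max 0 (x n - y n)"])
        (auto simp: negligible_zero z' intro!: always_eventually)
  qed
  finally show "rho_le U (rho_class U E (star U x)) (rho_class U E (star U y)) \<longleftrightarrow>
    (\<forall>m. \<forall>\<^sub>F n in U. x n \<le> y n + w m n)" .
qed

text \<open>The union in the definition runs over elements that differ by negligible reals, which the
  embedding sends to negligible complex elements.\<close>

lemma rho_complex_of_real_class:
  assumes scale: "growth_scale U B w"
    and moderate: "\<And>x :: nat \<Rightarrow> complex. star U x \<in> moderate U E \<longleftrightarrow> growth_scale.moderate_seq B x"
    and negligible: "\<And>x :: nat \<Rightarrow> complex. star U x \<in> negligible U E \<longleftrightarrow> growth_scale.negligible_seq U w x"
    and negligible_real: "\<And>x :: nat \<Rightarrow> real. star U x \<in> negligible U E \<longleftrightarrow> growth_scale.negligible_seq U w x"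
    and x: "growth_scale.moderate_seq B x"
  shows "rho_complex_of_real U E (rho_class U E (star U x))
    = rho_class U E (star U (\<lambda>n. complex_of_real (x n)))"
proof -
  interpret sequence_model U B w "rho_field U E" "\<lambda>x :: nat \<Rightarrow> complex. rho_class U E (star U x)"
    by (rule sequence_model_rho[OF scale moderate negligible])
  have mod: "moderate_seq (\<lambda>n. complex_of_real (x n))" if "moderate_seq x" for x
    using that by (simp add: moderate_seq_def)
  note mem = mem_rho_class_iff[OF free_ultrafilter negligible_real]
  show ?thesis
    unfolding rho_complex_of_real_def
  proof (rule UNION_eq_const)
    show "star U x \<in> rho_class U E (star U x)"
      unfolding mem by (rule exI[of _ "\<lambda>_. 0"]) (simp add: negligible_zero)
    fix A assume "A \<in> rho_class U E (star U x)"
    then obtain z where z: "negligible_seq z" "A = star U (\<lambda>n. z n + x n)"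
      unfolding mem by blast
    have "negligible_seq (\<lambda>n. complex_of_real (z n))"
      using z(1) by (simp add: negligible_seq_def)
    then show "rho_class U E (star_complex_of_real U A) = rho_class U E (star U (\<lambda>n. complex_of_real (x n)))"
      using x z mod[OF moderate_add[OF negligible_moderate[OF z(1)] x]] mod[OF x]
      unfolding star_complex_of_real_def z(2) star_map_star by (simp add: cls_eq_iff)
  qed
qed

text \<open>Powers of \<open>\<rho>\<close> in terms of \<open>n\<close>. At \<open>n = 0\<close> the sequences may differ, but \<open>U\<close> is free.\<close>

lemma rho_power:
  fixes k :: "nat \<Rightarrow> nat"
  assumes ultra: "free_ultrafilter U"
  shows "star_map2 U (powr) (rho U) (star U (\<lambda>n. real (k n))) = star U (\<lambda>n. (1 / real n) ^ k n)"
    and "star_map2 U (powr) (rho U) (\<ominus>\<^bsub>star_field U\<^esub> star U (\<lambda>n. real (k n))) = star U (\<lambda>n. real n ^ k n)"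
proof -
  interpret star: sequence_model U UNIV "\<lambda>_ _. 0" "star_field U" "star U :: (nat \<Rightarrow> real) \<Rightarrow> _"
    using ultra by (rule sequence_model_star)
  have pos: "\<forall>\<^sub>F n in U. 0 < real n" using star.eventually_ge[of 1] by (rule eventually_mono) simp
  have uminus: "\<ominus>\<^bsub>star_field U\<^esub> star U (\<lambda>n. real (k n)) = star U (\<lambda>n. - real (k n))"
    by (rule star.cls_uminus[symmetric]) (simp add: star.moderate_seq_def)
  show "star_map2 U (powr) (rho U) (star U (\<lambda>n. real (k n))) = star U (\<lambda>n. (1 / real n) ^ k n)"
    unfolding rho_def star_map2_star using pos
    by (intro star_eqI) (auto elim!: eventually_mono simp: powr_realpow)
  show "star_map2 U (powr) (rho U) (\<ominus>\<^bsub>star_field U\<^esub> star U (\<lambda>n. real (k n))) = star U (\<lambda>n. real n ^ k n)"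
    unfolding rho_def uminus star_map2_star using pos
    by (intro star_eqI) (auto elim!: eventually_mono simp: powr_minus powr_realpow power_one_over)
qed

lemma star_mem_moderate_negligible_iff:
  fixes x :: "nat \<Rightarrow> 'a::real_normed_field"
  assumes ultra: "free_ultrafilter U" and E: "E = (\<lambda>k. star U (\<lambda>n. real (k n))) ` S"
  shows "star U x \<in> moderate U E \<longleftrightarrow> (\<exists>k\<in>S. \<forall>\<^sub>F n in U. norm (x n) \<le> real n ^ k n)"
    and "star U x \<in> negligible U E \<longleftrightarrow> (\<forall>k\<in>S. \<forall>\<^sub>F n in U. norm (x n) \<le> (1 / real n) ^ k n)"
proof -
  interpret star: sequence_model U UNIV "\<lambda>_ _. 0" "star_field U" "star U :: (nat \<Rightarrow> 'a) \<Rightarrow> _"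
    using ultra by (rule sequence_model_star)
  have "star U x \<in> carrier (star_field U)" by (simp add: star.moderate_seq_def)
  then show "star U x \<in> moderate U E \<longleftrightarrow> (\<exists>k\<in>S. \<forall>\<^sub>F n in U. norm (x n) \<le> real n ^ k n)"
    "star U x \<in> negligible U E \<longleftrightarrow> (\<forall>k\<in>S. \<forall>\<^sub>F n in U. norm (x n) \<le> (1 / real n) ^ k n)"
    by (simp_all add: moderate_def negligible_def E rho_power[OF ultra] star_map_star star_le_star)
qed

text \<open>With nonstandard exponents the powers \<open>n ^ k n\<close> exceed any given sequence from \<open>n = 2\<close> on,
  for suitable \<open>k\<close>. Applied to the norms this makes every element moderate; applied to the inverses
  of the norms it leaves only 0 as a negligible element.\<close>

lemma star_nats_moderate_negligible:
  fixes x :: "nat \<Rightarrow> 'a::real_normed_field"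
  assumes ultra: "free_ultrafilter U"
  shows "star U x \<in> moderate U (star_nats U) \<longleftrightarrow> growth_scale.moderate_seq UNIV x"
    and "star U x \<in> negligible U (star_nats U) \<longleftrightarrow> growth_scale.negligible_seq U (\<lambda>_ _. 0) x"
proof -
  interpret growth_scale U UNIV "\<lambda>_ _. 0" using ultra by (rule growth_scale_all)
  have E: "star_nats U = (\<lambda>k. star U (\<lambda>n. real (k n))) ` UNIV" by (auto simp: star_nats_def)
  note iffs = star_mem_moderate_negligible_iff[OF ultra E]
  have "\<forall>t::real. \<exists>k. \<forall>n::nat\<ge>2. t < real n ^ k"
  proof
    fix t :: real
    obtain k where k: "t < 2 ^ k" using real_arch_pow[of 2 t] by auto
    have "t < real n ^ k" if "2 \<le> n" for n
      using k power_mono[of 2 "real n" k] that by simp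
    then show "\<exists>k. \<forall>n::nat\<ge>2. t < real n ^ k" by blast
  qed
  from choice[OF this] obtain k :: "real \<Rightarrow> nat" where k: "\<And>t n. 2 \<le> n \<Longrightarrow> t < real n ^ k t"
    by blast
  show "star U x \<in> moderate U (star_nats U) \<longleftrightarrow> moderate_seq x"
  proof -
    have "\<forall>\<^sub>F n in U. norm (x n) \<le> real n ^ k (norm (x n))"
      using eventually_ge[of 2] by eventually_elim (simp add: k less_imp_le)
    then show ?thesis
      using exI[of "\<lambda>k. \<forall>\<^sub>F n in U. norm (x n) \<le> real n ^ k n" "\<lambda>n. k (norm (x n))"]
      by (simp add: iffs moderate_seq_def)
  qed
  show "star U x \<in> negligible U (star_nats U) \<longleftrightarrow> negligible_seq x"
  proof
    assume "star U x \<in> negligible U (star_nats U)"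
    then have "\<forall>\<^sub>F n in U. norm (x n) \<le> (1 / real n) ^ k (1 / norm (x n))" by (simp add: iffs)
    then have "\<forall>\<^sub>F n in U. x n = 0"
      using eventually_ge[of 2]
    proof eventually_elim
      case (elim n)
      show ?case
      proof (rule ccontr)
        assume "x n \<noteq> 0"
        define N where "N = real n ^ k (1 / norm (x n))"
        have "1 / norm (x n) < N" using k[of n "1 / norm (x n)"] elim(2) by (simp add: N_def)
        then have "1 < norm (x n) * N" using \<open>x n \<noteq> 0\<close> by (simp add: field_simps)
        moreover have "0 < N" "norm (x n) \<le> 1 / N"
          using elim by (simp_all add: N_def power_one_over)
        then have "norm (x n) * N \<le> 1" by (simp add: field_simps)
        ultimately show False by simp
      qed
    qed
    then show "negligible_seq x" by (simp add: negligible_seq_def)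
  next
    assume "negligible_seq x"
    then show "star U x \<in> negligible U (star_nats U)"
      by (auto simp: iffs negligible_seq_def elim: eventually_mono)
  qed
qed

text \<open>The scale of Robinson's asymptotic numbers: polynomial growth, and thresholds \<open>n ^ (- m)\<close>.\<close>

lemma growth_scale_polynomial:
  assumes "free_ultrafilter U"
  shows "growth_scale U {x. \<exists>k. \<forall>\<^sub>F n in U. \<bar>x n\<bar> \<le> real n ^ k} (\<lambda>m n. (1 / real n) ^ m)"
proof -
  interpret all: growth_scale U UNIV "\<lambda>_ _. 0" using assms by (rule growth_scale_all)
  note ge = all.eventually_ge
  show ?thesis
  proof
    show "free_ultrafilter U" by fact
  next
    fix x y :: "nat \<Rightarrow> real"
    assume "y \<in> {x. \<exists>k. \<forall>\<^sub>F n in U. \<bar>x n\<bar> \<le> real n ^ k}" and le: "\<forall>\<^sub>F n in U. \<bar>x n\<bar> \<le> y n"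
    then obtain k where "\<forall>\<^sub>F n in U. \<bar>y n\<bar> \<le> real n ^ k" by blast
    with le have "\<forall>\<^sub>F n in U. \<bar>x n\<bar> \<le> real n ^ k" by eventually_elim linarith
    then show "x \<in> {x. \<exists>k. \<forall>\<^sub>F n in U. \<bar>x n\<bar> \<le> real n ^ k}" by blast
  next
    fix x y :: "nat \<Rightarrow> real"
    assume "x \<in> {x. \<exists>k. \<forall>\<^sub>F n in U. \<bar>x n\<bar> \<le> real n ^ k}" "y \<in> {x. \<exists>k. \<forall>\<^sub>F n in U. \<bar>x n\<bar> \<le> real n ^ k}"
    then obtain k l where kl: "\<forall>\<^sub>F n in U. \<bar>x n\<bar> \<le> real n ^ k" "\<forall>\<^sub>F n in U. \<bar>y n\<bar> \<le> real n ^ l" by blast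
    from kl have "\<forall>\<^sub>F n in U. \<bar>x n * y n\<bar> \<le> real n ^ (k + l)"
      by eventually_elim (simp add: abs_mult power_add mult_mono)
    then show "(\<lambda>n. x n * y n) \<in> {x. \<exists>k. \<forall>\<^sub>F n in U. \<bar>x n\<bar> \<le> real n ^ k}" by blast
    from kl ge[of 2] have "\<forall>\<^sub>F n in U. \<bar>x n + y n\<bar> \<le> real n ^ (max k l + 1)"
    proof eventually_elim
      case (elim n)
      have "real n ^ k \<le> real n ^ max k l" "real n ^ l \<le> real n ^ max k l"
        using elim by (auto intro: power_increasing)
      then have "\<bar>x n + y n\<bar> \<le> 2 * real n ^ max k l" using elim by linarith
      also have "\<dots> \<le> real n * real n ^ max k l" using elim by (intro mult_right_mono) auto
      finally show ?case by simp
    qed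
    then show "(\<lambda>n. x n + y n) \<in> {x. \<exists>k. \<forall>\<^sub>F n in U. \<bar>x n\<bar> \<le> real n ^ k}" by blast
  next
    show "real \<in> {x. \<exists>k. \<forall>\<^sub>F n in U. \<bar>x n\<bar> \<le> real n ^ k}"
      by (auto intro!: exI[of _ 1])
  next
    fix k m n :: nat
    have le: "1 / real n \<le> 1" by (cases n) auto
    then show "(1 / real n) ^ m \<le> 1" by (simp add: power_le_one)
    show "(1 / real n) ^ m \<le> (1 / real n) ^ k" if "k \<le> m"
      using le that by (intro power_decreasing) auto
  next
    fix y :: "nat \<Rightarrow> real" and m
    assume "y \<in> {x. \<exists>k. \<forall>\<^sub>F n in U. \<bar>x n\<bar> \<le> real n ^ k}"
    then obtain k where "\<forall>\<^sub>F n in U. \<bar>y n\<bar> \<le> real n ^ k" by blast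
    then have "\<forall>\<^sub>F n in U. y n * (1 / real n) ^ (k + m) \<le> (1 / real n) ^ m"
      using ge[of 1]
    proof eventually_elim
      case (elim n)
      have "y n * (1 / real n) ^ (k + m) \<le> real n ^ k * (1 / real n) ^ (k + m)"
        using elim by (intro mult_right_mono) auto
      also have "\<dots> = (1 / real n) ^ m" using elim by (simp add: power_add field_simps)
      finally show ?case .
    qed
    then show "\<exists>k. \<forall>\<^sub>F n in U. y n * (1 / real n) ^ k \<le> (1 / real n) ^ m" by blast
  next
    fix x :: "nat \<Rightarrow> real" and m
    assume "\<forall>\<^sub>F n in U. (1 / real n) ^ m < x n"
    then have "\<forall>\<^sub>F n in U. \<bar>inverse (x n)\<bar> \<le> real n ^ m"
      using ge[of 1]
    proof eventually_elim
      case (elim n)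
      have pos: "0 < (1 / real n) ^ m" using elim(2) by simp
      then have "0 < x n" using elim(1) by linarith
      moreover have "inverse (x n) \<le> inverse ((1 / real n) ^ m)"
        using elim(1) pos by (intro le_imp_inverse_le less_imp_le)
      ultimately show ?case by (simp add: power_one_over)
    qed
    then show "(\<lambda>n. inverse (x n)) \<in> {x. \<exists>k. \<forall>\<^sub>F n in U. \<bar>x n\<bar> \<le> real n ^ k}" by blast
  qed simp
qed

lemma standard_nats_moderate_negligible:
  fixes x :: "nat \<Rightarrow> 'a::real_normed_field"
  assumes ultra: "free_ultrafilter U"
  shows "star U x \<in> moderate U (standard_nats U) \<longleftrightarrow>
      growth_scale.moderate_seq {x. \<exists>k. \<forall>\<^sub>F n in U. \<bar>x n\<bar> \<le> real n ^ k} x"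
    and "star U x \<in> negligible U (standard_nats U) \<longleftrightarrow>
      growth_scale.negligible_seq U (\<lambda>m n. (1 / real n) ^ m) x"
proof -
  interpret growth_scale U "{x. \<exists>k. \<forall>\<^sub>F n in U. \<bar>x n\<bar> \<le> real n ^ k}" "\<lambda>m n. (1 / real n) ^ m"
    using ultra by (rule growth_scale_polynomial)
  have E: "standard_nats U = (\<lambda>k. star U (\<lambda>n. real (k n))) ` range (\<lambda>m _. m)"
    by (auto simp: standard_nats_def)
  show "star U x \<in> moderate U (standard_nats U) \<longleftrightarrow> moderate_seq x"
    "star U x \<in> negligible U (standard_nats U) \<longleftrightarrow> negligible_seq x"
    by (simp_all add: star_mem_moderate_negligible_iff[OF ultra E] moderate_seq_def negligible_seq_def)
qed

section \<open>Real closed fields with their complexifications\<close>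

text \<open>Here \<open>\<iota>\<close> is the canonical embedding of the reals into \<open>R\<close>, \<open>e\<close> that of \<open>R\<close> into \<open>C\<close>, and \<open>j\<close>
  is the square root of \<open>- 1\<close> in \<open>C\<close>.\<close>

definition real_complex_pair ::
    "('b, 'm) ring_scheme \<Rightarrow> ('b \<Rightarrow> 'b \<Rightarrow> bool) \<Rightarrow> (real \<Rightarrow> 'b) \<Rightarrow> ('c, 'n) ring_scheme
      \<Rightarrow> ('b \<Rightarrow> 'c) \<Rightarrow> 'c \<Rightarrow> bool" where
  "real_complex_pair R leq \<iota> C e j \<longleftrightarrow>
     (real_closed_field R leq \<and> cantor_complete R leq \<and> \<not> archimedean R leq \<and>
      ordered_embedding real_ring (\<le>) R leq \<iota>) \<and>
     (algebraically_closed C \<and> is_complexification R C e j)"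

lemma real_complex_pair_of_models:
  assumes "ordered_sequence_model U B w R clsR leq" "sequence_model U B w C clsC"
    and "\<And>x. growth_scale.moderate_seq B x \<Longrightarrow> e (clsR x) = clsC (\<lambda>n. complex_of_real (x n))"
    and "\<And>r. \<iota> r = clsR (\<lambda>_. r)" and "j = clsC (\<lambda>_. \<i>)"
  shows "real_complex_pair R leq \<iota> C e j"
proof -
  interpret R: ordered_sequence_model U B w R clsR leq by fact
  have \<iota>: "\<iota> = (\<lambda>r. clsR (\<lambda>_. r))" using assms(4) by auto
  show ?thesis
    unfolding real_complex_pair_def \<iota> assms(5)
    using R.real_closed_field_K R.cantor_complete_K R.not_archimedean_K R.ordered_embedding_reals
      algebraically_closed_complex_model[OF assms(2)]
      complexification_of_models[OF R.sequence_model_axioms assms(2,3)]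
    by blast
qed

lemma real_complex_pair_rho:
  assumes scale: "growth_scale U B w"
    and real: "\<And>x :: nat \<Rightarrow> real. star U x \<in> moderate U E \<longleftrightarrow> growth_scale.moderate_seq B x"
      "\<And>x :: nat \<Rightarrow> real. star U x \<in> negligible U E \<longleftrightarrow> growth_scale.negligible_seq U w x"
    and complex: "\<And>x :: nat \<Rightarrow> complex. star U x \<in> moderate U E \<longleftrightarrow> growth_scale.moderate_seq B x"
      "\<And>x :: nat \<Rightarrow> complex. star U x \<in> negligible U E \<longleftrightarrow> growth_scale.negligible_seq U w x"
  shows "real_complex_pair (rho_real U E) (rho_le U) (real_to_rho U E)
    (rho_complex U E) (rho_complex_of_real U E) (rho_ii U E)"
  by (rule real_complex_pair_of_models[OF ordered_sequence_model_rho[OF scale real]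
        sequence_model_rho[OF scale complex]])
    (simp_all add: rho_complex_of_real_class[OF scale complex real(2)]
      real_to_rho_def real_to_star_def rho_ii_def star_ii_def)

theorem proposition2p6:
  fixes U :: "nat filter"
  assumes "free_ultrafilter U"
  shows
    "(real_closed_field (star_real U) (star_le U) \<and>
      cantor_complete (star_real U) (star_le U) \<and>
      \<not> archimedean (star_real U) (star_le U) \<and>
      ordered_embedding real_ring (\<le>) (star_real U) (star_le U) (real_to_star U)) \<and>
     (algebraically_closed (star_complex U) \<and>
      is_complexification (star_real U) (star_complex U) (star_complex_of_real U) (star_ii U)) \<and>
     (\<forall>E \<in> {star_nats U, standard_nats U}.
       (real_closed_field (rho_real U E) (rho_le U) \<and>
        cantor_complete (rho_real U E) (rho_le U) \<and>
        \<not> archimedean (rho_real U E) (rho_le U) \<and>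
        ordered_embedding real_ring (\<le>) (rho_real U E) (rho_le U) (real_to_rho U E)) \<and>
       (algebraically_closed (rho_complex U E) \<and>
        is_complexification (rho_real U E) (rho_complex U E) (rho_complex_of_real U E) (rho_ii U E)))"
proof -
  have "real_complex_pair (star_real U) (star_le U) (real_to_star U)
      (star_complex U) (star_complex_of_real U) (star_ii U)"
    by (rule real_complex_pair_of_models[OF ordered_sequence_model_star[OF assms]
          sequence_model_star[OF assms]])
      (simp_all add: star_complex_of_real_def star_map_star real_to_star_def star_ii_def)
  moreover have "real_complex_pair (rho_real U (star_nats U)) (rho_le U) (real_to_rho U (star_nats U))
      (rho_complex U (star_nats U)) (rho_complex_of_real U (star_nats U)) (rho_ii U (star_nats U))"
    by (intro real_complex_pair_rho[OF growth_scale_all] star_nats_moderate_negligible assms)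
  moreover have "real_complex_pair (rho_real U (standard_nats U)) (rho_le U) (real_to_rho U (standard_nats U))
      (rho_complex U (standard_nats U)) (rho_complex_of_real U (standard_nats U)) (rho_ii U (standard_nats U))"
    by (intro real_complex_pair_rho[OF growth_scale_polynomial] standard_nats_moderate_negligible assms)
  ultimately show ?thesis
    unfolding real_complex_pair_def by simp
qed

end
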